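(* Let $n,n'\ge 2$ be integers and let $G$ be the Cayley graph of the Coxeter system $\mathbf{I_2}(n)$ or of $\mathbf{I_2}(n)\times\mathbf{I_2}(n')$. Then $\sigma(G)=\lceil\sqrt{\kappa(G)}\rceil$.
   Context: $\mathbf{I_2}(m)$ is the Coxeter system $(\langle s,t\mid s^2=t^2=(st)^m=1\rangle,\{s,t\})$, whose Cayley graph is the cycle $C_{2m}$. The product of Coxeter systems $(W,S)$, $(W',S')$ is $(W\times W',S\times\{e'\}\cup\{e\}\times S')$; the Cayley graph of $\mathbf{I_2}(n)\times\mathbf{I_2}(n')$ is $C_{2n}\square C_{2n'}$. The Cayley graph of $(W,S)$ has $x\sim y$ iff $x^{-1}y\in S$. $\kappa(G)$ is the largest $d$ with $Q_d$ a subgraph of $G$; $\sigma(G)$ is the minimum of the maximum degree of $G[K]$ over vertex sets $K$ with $|K|>\alpha(G)$. *)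

theory Defs
  imports
    Complex_Main
    "HOL-Algebra.Group"
    "Graph_Theory.Digraph_Isomorphism"
    "Graph_Theory.Pair_Digraph"
begin

section \<open>Groups given by generators and relators\<close>

text \<open>
  A word is a list of letters \<open>(x, b)\<close>, where \<open>(x, True)\<close> stands for the generator \<open>x\<close> and
  \<open>(x, False)\<close> for its formal inverse.
\<close>

type_synonym 'x group_word = "('x \<times> bool) list"

inductive pres_eq :: "'x group_word set \<Rightarrow> 'x group_word \<Rightarrow> 'x group_word \<Rightarrow> bool"
  for R :: "'x group_word set" where
  refl: "pres_eq R u u"
| sym: "pres_eq R u v \<Longrightarrow> pres_eq R v u"
| trans: "pres_eq R u v \<Longrightarrow> pres_eq R v w \<Longrightarrow> pres_eq R u w"
| cancel: "pres_eq R (u @ [(x, b), (x, \<not> b)] @ v) (u @ v)"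
| relator: "r \<in> R \<Longrightarrow> pres_eq R (u @ r @ v) (u @ v)"

definition pres_class :: "'x group_word set \<Rightarrow> 'x group_word \<Rightarrow> 'x group_word set" where
  "pres_class R u = {v. pres_eq R u v}"

text \<open>The group \<open>\<langle>X | R\<rangle>\<close>, where \<open>X\<close> is the whole type \<open>'x\<close>.\<close>

definition presented_group :: "'x group_word set \<Rightarrow> 'x group_word set monoid" where
  "presented_group R =
    \<lparr>carrier = range (pres_class R),
     monoid.mult = (\<lambda>A B. \<Union>u\<in>A. \<Union>v\<in>B. pres_class R (u @ v)),
     one = pres_class R []\<rparr>"

definition presented_gen :: "'x group_word set \<Rightarrow> 'x \<Rightarrow> 'x group_word set" where
  "presented_gen R x = pres_class R [(x, True)]"

lemma pres_eq_append_left: "pres_eq R u v \<Longrightarrow> pres_eq R (w @ u) (w @ v)"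
proof (induction rule: pres_eq.induct)
  case (cancel u x b v)
  then show ?case using pres_eq.cancel[of R "w @ u" x b v] by simp
next
  case (relator r u v)
  then show ?case using pres_eq.relator[of r R "w @ u" v] by simp
qed (auto intro: pres_eq.intros)

lemma pres_eq_append_right: "pres_eq R u v \<Longrightarrow> pres_eq R (u @ w) (v @ w)"
proof (induction rule: pres_eq.induct)
  case (cancel u x b v)
  then show ?case using pres_eq.cancel[of R u x b "v @ w"] by simp
next
  case (relator r u v)
  then show ?case using pres_eq.relator[of r R u "v @ w"] by simp
qed (auto intro: pres_eq.intros)

lemma pres_class_eq_iff: "pres_class R u = pres_class R v \<longleftrightarrow> pres_eq R u v"
  by (auto simp: pres_class_def set_eq_iff intro: pres_eq.intros)

lemma presented_group_carrier: "carrier (presented_group R) = range (pres_class R)"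
  by (simp add: presented_group_def)

lemma presented_group_mult:
  "pres_class R u \<otimes>\<^bsub>presented_group R\<^esub> pres_class R v = pres_class R (u @ v)"
proof -
  have eq: "pres_class R (u' @ v') = pres_class R (u @ v)"
    if "u' \<in> pres_class R u" "v' \<in> pres_class R v" for u' v'
  proof -
    have "pres_eq R u' u" "pres_eq R v' v"
      using that by (auto simp: pres_class_def intro: pres_eq.sym)
    then show ?thesis
      unfolding pres_class_eq_iff
      by (rule pres_eq.trans[OF pres_eq_append_right pres_eq_append_left])
  qed
  have mem: "w \<in> pres_class R w" for w
    by (simp add: pres_class_def pres_eq.refl)
  have "(\<Union>u'\<in>pres_class R u. \<Union>v'\<in>pres_class R v. pres_class R (u' @ v')) =
      pres_class R (u @ v)"
    using eq mem by blast
  then show ?thesis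
    by (simp add: presented_group_def)
qed

lemma presented_group_inverse:
  "pres_eq R (map (\<lambda>(x, b). (x, \<not> b)) (rev u) @ u) []"
proof (induction u)
  case Nil
  show ?case by (simp add: pres_eq.refl)
next
  case (Cons a u)
  obtain x b where a: "a = (x, b)" by (cases a)
  show ?case
    using pres_eq.trans[OF pres_eq.cancel[of R "map (\<lambda>(x, b). (x, \<not> b)) (rev u)" x "\<not> b" u] Cons.IH]
    by (simp add: a)
qed

lemma group_presented_group: "group (presented_group R)"
proof (rule groupI)
  fix A B C
  assume "A \<in> carrier (presented_group R)" "B \<in> carrier (presented_group R)"
    "C \<in> carrier (presented_group R)"
  then show "A \<otimes>\<^bsub>presented_group R\<^esub> B \<otimes>\<^bsub>presented_group R\<^esub> C =
      A \<otimes>\<^bsub>presented_group R\<^esub> (B \<otimes>\<^bsub>presented_group R\<^esub> C)"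
    by (auto simp: presented_group_carrier presented_group_mult)
next
  fix A
  assume "A \<in> carrier (presented_group R)"
  then obtain u where u: "A = pres_class R u"
    by (auto simp: presented_group_def)
  have one: "\<one>\<^bsub>presented_group R\<^esub> = pres_class R []"
    by (simp add: presented_group_def)
  show "\<one>\<^bsub>presented_group R\<^esub> \<otimes>\<^bsub>presented_group R\<^esub> A = A"
    by (simp add: one u presented_group_mult)
  have "pres_class R (map (\<lambda>(x, b). (x, \<not> b)) (rev u)) \<otimes>\<^bsub>presented_group R\<^esub> A
      = \<one>\<^bsub>presented_group R\<^esub>"
    unfolding one u presented_group_mult pres_class_eq_iff by (rule presented_group_inverse)
  moreover have "pres_class R (map (\<lambda>(x, b). (x, \<not> b)) (rev u)) \<in> carrier (presented_group R)"
    by (simp add: presented_group_def)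
  ultimately show "\<exists>B\<in>carrier (presented_group R). B \<otimes>\<^bsub>presented_group R\<^esub> A
      = \<one>\<^bsub>presented_group R\<^esub>"
    by blast
next
  fix A B
  assume "A \<in> carrier (presented_group R)" "B \<in> carrier (presented_group R)"
  then show "A \<otimes>\<^bsub>presented_group R\<^esub> B \<in> carrier (presented_group R)"
    by (auto simp: presented_group_carrier presented_group_mult)
next
  show "\<one>\<^bsub>presented_group R\<^esub> \<in> carrier (presented_group R)"
    by (simp add: presented_group_def)
qed


section \<open>The Coxeter systems\<close>

text \<open>A Coxeter system is represented by its pair \<open>(W, S)\<close> of a group and a generating set.\<close>

type_synonym 'a group_with_gens = "'a monoid \<times> 'a set"

datatype dihedral_gen = gen_s | gen_t

definition I2_relators :: "nat \<Rightarrow> dihedral_gen group_word set" where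
  "I2_relators m =
    {[(gen_s, True), (gen_s, True)],
     [(gen_t, True), (gen_t, True)],
     concat (replicate m [(gen_s, True), (gen_t, True)])}"

definition I2 :: "nat \<Rightarrow> dihedral_gen group_word set group_with_gens" where
  "I2 m = (presented_group (I2_relators m),
     {presented_gen (I2_relators m) gen_s, presented_gen (I2_relators m) gen_t})"

definition coxeter_prod ::
  "'a group_with_gens \<Rightarrow> 'b group_with_gens \<Rightarrow> ('a \<times> 'b) group_with_gens" where
  "coxeter_prod = (\<lambda>(W, S) (W', S').
     (W \<times>\<times> W', S \<times> {\<one>\<^bsub>W'\<^esub>} \<union> {\<one>\<^bsub>W\<^esub>} \<times> S'))"


section \<open>Graphs\<close>

text \<open>
  A simple graph is a symmetric loop-free digraph without parallel arcs (locale \<open>graph\<close>); each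
  edge is a pair of opposite arcs, so that the degree of a vertex is its out-degree.
\<close>

definition cayley_graph :: "'a group_with_gens \<Rightarrow> ('a, 'a \<times> 'a) pre_digraph" where
  "cayley_graph = (\<lambda>(W, S). with_proj
    \<lparr>pverts = carrier W,
     parcs = {(x, y). x \<in> carrier W \<and> y \<in> carrier W \<and> inv\<^bsub>W\<^esub> x \<otimes>\<^bsub>W\<^esub> y \<in> S}\<rparr>)"

definition hypercube :: "nat \<Rightarrow> (bool list, bool list \<times> bool list) pre_digraph" where
  "hypercube d = with_proj
    \<lparr>pverts = {xs. length xs = d},
     parcs = {(xs, ys). length xs = d \<and> length ys = d \<and> card {i. i < d \<and> xs ! i \<noteq> ys ! i} = 1}\<rparr>"

text \<open>Subgraphs are taken up to isomorphism and need not be induced.\<close>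

definition has_hypercube :: "('a, 'b) pre_digraph \<Rightarrow> nat \<Rightarrow> bool" where
  "has_hypercube G d \<longleftrightarrow> (\<exists>H. subgraph H G \<and> digraph_iso (hypercube d) H)"

definition kappa :: "('a, 'b) pre_digraph \<Rightarrow> nat" where
  "kappa G = Max {d. has_hypercube G d}"

definition independent_set :: "('a, 'b) pre_digraph \<Rightarrow> 'a set \<Rightarrow> bool" where
  "independent_set G A \<longleftrightarrow> A \<subseteq> verts G \<and> (\<forall>x\<in>A. \<forall>y\<in>A. (x, y) \<notin> arcs_ends G)"

definition independence_number :: "('a, 'b) pre_digraph \<Rightarrow> nat" where
  "independence_number G = Max (card ` {A. independent_set G A})"

definition max_degree :: "('a, 'b) pre_digraph \<Rightarrow> nat" where
  "max_degree G = Max (out_degree G ` verts G)"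

text \<open>
  As \<open>Min\<close> is applied to a nonempty set only if some vertex set is larger than every independent
  set, \<open>sigma\<close> is meaningful for finite graphs with at least one edge.
\<close>

definition sigma :: "('a, 'b) pre_digraph \<Rightarrow> nat" where
  "sigma G = Min ((\<lambda>K. max_degree (G \<restriction> K)) ` {K. K \<subseteq> verts G \<and> independence_number G < card K})"

end

theory Submission
  imports Defs "HOL-Number_Theory.Cong"
begin

text \<open>
  The Cayley graphs are \<open>C\<^bsub>2n\<^esub>\<close> and the torus \<open>C\<^bsub>2n\<^esub> \<box> C\<^bsub>2n'\<^esub>\<close>. The torus contains a square and has
  degree \<open>4\<close>, so \<open>2 \<le> \<kappa> \<le> 4\<close> and \<open>\<lceil>\<surd>\<kappa>\<rceil> = 2\<close>. Its vertices split into \<open>2 \<times> 2\<close> squares, so a set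
  containing more than half of them meets some square in three vertices, one of which has two
  neighbours in the set; hence \<open>\<sigma> \<ge> 2\<close>. Conversely, changing parity along one horizontal
  and one vertical cycle turns a maximum independent set into a larger set of maximum degree \<open>2\<close>. For
  \<open>C\<^bsub>2n\<^esub>\<close> with \<open>n \<ge> 3\<close>, removing \<open>2\<close> from the even vertices and adding \<open>1\<close> and \<open>3\<close> gives
  \<open>\<sigma> = 1 = \<kappa>\<close>, while \<open>C\<^sub>4\<close> is itself a square.
\<close>


section \<open>Degrees, independent sets and embedded cubes\<close>

lemma out_degree_with_proj_induce:
  assumes "v \<in> K"
  shows "out_degree (with_proj G \<restriction> K) v = card {w \<in> K. (v, w) \<in> parcs G}"
proof -
  have "out_arcs (with_proj G \<restriction> K) v = Pair v ` {w \<in> K. (v, w) \<in> parcs G}"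
    using assms by (auto simp: out_arcs_def induce_subgraph_def)
  then show ?thesis
    by (simp add: out_degree_def card_image inj_on_def)
qed

lemma finite_independent_sets:
  assumes "finite (verts G)"
  shows "finite {A. independent_set G A}"
  by (rule finite_subset[of _ "Pow (verts G)"]) (auto simp: independent_set_def assms)

lemma card_le_independence_number:
  assumes "finite (verts G)" "independent_set G A"
  shows "card A \<le> independence_number G"
  unfolding independence_number_def
  using assms finite_independent_sets[OF assms(1)] by (intro Max_ge) auto

lemma independence_number_eqI:
  assumes "finite (verts G)" "independent_set G A" "card A = a"
    and "\<And>B. independent_set G B \<Longrightarrow> card B \<le> a"
  shows "independence_number G = a"
  unfolding independence_number_def
  using assms finite_independent_sets[OF assms(1)] by (intro Max_eqI) auto

text \<open>A min-max value is certified from both sides: one large set \<open>K\<close> with all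
  degrees at most \<open>d\<close> bounds it above, and a vertex of degree at least \<open>d\<close>
  in every large set bounds it below.\<close>

lemma sigma_eqI:
  assumes fin: "finite (pverts G)"
    and K: "K \<subseteq> pverts G" "independence_number (with_proj G) < card K"
    and upper: "\<And>v. v \<in> K \<Longrightarrow> card {w \<in> K. (v, w) \<in> parcs G} \<le> d"
    and lower: "\<And>L. L \<subseteq> pverts G \<Longrightarrow> independence_number (with_proj G) < card L \<Longrightarrow>
      \<exists>v\<in>L. d \<le> card {w \<in> L. (v, w) \<in> parcs G}"
  shows "sigma (with_proj G) = d"
proof -
  let ?F = "{L. L \<subseteq> pverts G \<and> independence_number (with_proj G) < card L}"
  have deg: "max_degree (with_proj G \<restriction> L) = Max ((\<lambda>v. card {w \<in> L. (v, w) \<in> parcs G}) ` L)" for L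
    unfolding max_degree_def
    by (rule arg_cong[of _ _ Max]) (auto simp: out_degree_with_proj_induce image_def)
  have ge: "d \<le> max_degree (with_proj G \<restriction> L)" if L: "L \<in> ?F" for L
  proof -
    obtain v where "v \<in> L" "d \<le> card {w \<in> L. (v, w) \<in> parcs G}"
      using lower L by blast
    moreover have "finite L"
      using L fin finite_subset by blast
    ultimately show ?thesis
      unfolding deg by (meson Max_ge finite_imageI imageI order_trans)
  qed
  have "max_degree (with_proj G \<restriction> K) \<le> d"
  proof -
    \<comment> \<open>\<open>K\<close> is nonempty because its cardinality exceeds a natural number;
      \<open>Max\<close> of the empty set would be unspecified.\<close>
    have "finite K" "K \<noteq> {}"
      using K fin finite_subset by auto
    then show ?thesis
      unfolding deg using upper by (subst Max_le_iff) auto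
  qed
  \<comment> \<open>The lower bound applied to \<open>K\<close> itself turns the upper bound into an
    equality, so \<open>d\<close> is attained.\<close>
  then have "d \<in> (\<lambda>L. max_degree (with_proj G \<restriction> L)) ` ?F"
    using ge[of K] K by (intro image_eqI[of _ _ K]) auto
  moreover have "finite ?F"
    using fin by simp
  ultimately show ?thesis
    unfolding sigma_def using ge by (intro Min_eqI) auto
qed

section \<open>Transport of the invariants along graph isomorphisms\<close>

definition pair_iso :: "('a \<Rightarrow> 'b) \<Rightarrow> 'a pair_pre_digraph \<Rightarrow> 'b pair_pre_digraph \<Rightarrow> bool" where
  "pair_iso f G H \<longleftrightarrow> bij_betw f (pverts G) (pverts H) \<and>
    (\<forall>x\<in>pverts G. \<forall>y\<in>pverts G. (f x, f y) \<in> parcs H \<longleftrightarrow> (x, y) \<in> parcs G)"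

lemma pair_iso_independent_sets:
  assumes "pair_iso f G H"
  shows "{B. independent_set (with_proj H) B} = image f ` {A. independent_set (with_proj G) A}"
proof -
  have f: "f ` pverts G = pverts H"
    and e: "\<And>x y. x \<in> pverts G \<Longrightarrow> y \<in> pverts G \<Longrightarrow> (f x, f y) \<in> parcs H \<longleftrightarrow> (x, y) \<in> parcs G"
    using assms by (auto simp: pair_iso_def bij_betw_def)
  show ?thesis
  proof (intro equalityI subsetI)
    fix B assume "B \<in> {B. independent_set (with_proj H) B}"
    then have B: "B \<subseteq> f ` pverts G" "\<forall>x\<in>B. \<forall>y\<in>B. (x, y) \<notin> parcs H"
      by (auto simp: independent_set_def f)
    then obtain A where A: "A \<subseteq> pverts G" "B = f ` A"
      by (meson subset_imageE)
    moreover have "(x, y) \<notin> parcs G" if "x \<in> A" "y \<in> A" for x y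
      using that A B(2) e[of x y] by blast
    ultimately have "independent_set (with_proj G) A"
      by (simp add: independent_set_def)
    with A(2) show "B \<in> image f ` {A. independent_set (with_proj G) A}"
      by blast
  next
    fix B assume "B \<in> image f ` {A. independent_set (with_proj G) A}"
    then obtain A where A: "A \<subseteq> pverts G" "\<forall>x\<in>A. \<forall>y\<in>A. (x, y) \<notin> parcs G" "B = f ` A"
      by (auto simp: independent_set_def)
    then have "(f x, f y) \<notin> parcs H" if "x \<in> A" "y \<in> A" for x y
      using that e[of x y] by blast
    with A show "B \<in> {B. independent_set (with_proj H) B}"
      by (auto simp: independent_set_def f[symmetric])
  qed
qed

lemma pair_iso_independence_number:
  assumes "pair_iso f G H"
  shows "independence_number (with_proj H) = independence_number (with_proj G)"
proof -
  have "card (f ` A) = card A" if "independent_set (with_proj G) A" for A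
    using that assms unfolding independent_set_def pair_iso_def bij_betw_def with_proj_simps
    by (meson card_image inj_on_subset)
  then have "card ` image f ` {A. independent_set (with_proj G) A} =
      card ` {A. independent_set (with_proj G) A}"
    unfolding image_image by (intro image_cong) auto
  then show ?thesis
    by (simp add: independence_number_def pair_iso_independent_sets[OF assms])
qed

lemma pair_iso_max_degree_induce:
  assumes "pair_iso f G H" "K \<subseteq> pverts G"
  shows "max_degree (with_proj H \<restriction> f ` K) = max_degree (with_proj G \<restriction> K)"
proof -
  have inj: "inj_on f K"
    using assms by (auto simp: pair_iso_def bij_betw_def intro: inj_on_subset)
  have iff: "(f v, f w) \<in> parcs H \<longleftrightarrow> (v, w) \<in> parcs G" if "v \<in> K" "w \<in> K" for v w
    using assms that unfolding pair_iso_def by blast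
  have "out_degree (with_proj H \<restriction> f ` K) (f v) = out_degree (with_proj G \<restriction> K) v" if v: "v \<in> K" for v
  proof -
    have "{w \<in> f ` K. (f v, w) \<in> parcs H} = f ` {w \<in> K. (v, w) \<in> parcs G}"
      using iff[OF v] by blast
    moreover have "card (f ` {w \<in> K. (v, w) \<in> parcs G}) = card {w \<in> K. (v, w) \<in> parcs G}"
      by (rule card_image) (auto intro: inj_on_subset[OF inj])
    ultimately show ?thesis
      using v by (simp add: out_degree_with_proj_induce)
  qed
  then show ?thesis
    by (simp add: max_degree_def image_image)
qed

lemma pair_iso_sigma:
  assumes "pair_iso f G H"
  shows "sigma (with_proj H) = sigma (with_proj G)"
proof -
  let ?a = "independence_number (with_proj G)"
  have inj: "inj_on f (pverts G)" and f: "pverts H = f ` pverts G"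
    using assms by (auto simp: pair_iso_def bij_betw_def)
  have card: "card (f ` K) = card K" if "K \<subseteq> pverts G" for K
    using that inj by (meson card_image inj_on_subset)
  \<comment> \<open>The threshold is the same in both graphs and \<open>f\<close> preserves
    cardinalities, so the large sets of \<open>H\<close> are exactly the images of those of
    \<open>G\<close>.\<close>
  have "{K. K \<subseteq> pverts H \<and> ?a < card K} = image f ` {K. K \<subseteq> pverts G \<and> ?a < card K}"
    unfolding f by (auto simp: card elim!: subset_imageE)
  then have "(\<lambda>K. max_degree (with_proj H \<restriction> K)) ` {K. K \<subseteq> pverts H \<and> ?a < card K} =
      (\<lambda>K. max_degree (with_proj H \<restriction> f ` K)) ` {K. K \<subseteq> pverts G \<and> ?a < card K}"
    by (simp add: image_image)
  also have "\<dots> = (\<lambda>K. max_degree (with_proj G \<restriction> K)) ` {K. K \<subseteq> pverts G \<and> ?a < card K}"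
    by (rule image_cong) (auto simp: pair_iso_max_degree_induce[OF assms])
  finally show ?thesis
    by (simp add: sigma_def pair_iso_independence_number[OF assms])
qed

section \<open>Embedded hypercubes and bounds on their dimension\<close>

lemma wf_hypercube: "wf_digraph (hypercube d)"
  by unfold_locales (auto simp: hypercube_def)

text \<open>Arcs of the host are pairs of vertices, so a copy of the cube is determined by its
  vertex map. Only preservation of arcs is asked, as the copy need not be induced.\<close>

lemma has_hypercube_iff:
  assumes wf: "pair_wf_digraph G"
  shows "has_hypercube (with_proj G) d \<longleftrightarrow>
    (\<exists>\<phi>. inj_on \<phi> {xs. length xs = d} \<and> \<phi> ` {xs. length xs = d} \<subseteq> pverts G \<and>
      (\<forall>xs ys. (xs, ys) \<in> arcs (hypercube d) \<longrightarrow> (\<phi> xs, \<phi> ys) \<in> parcs G))"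
    (is "?L \<longleftrightarrow> (\<exists>\<phi>. ?P \<phi>)")
proof
  assume ?L
  then obtain h where h: "subgraph (app_iso h (hypercube d)) (with_proj G)"
      "pre_digraph.digraph_isomorphism (hypercube d) h"
    by (auto simp: has_hypercube_def digraph_iso_def)
  \<comment> \<open>Compatibility with \<open>with_proj G\<close> forces the end maps to be the
    projections, so the arc map is induced by the vertex map.\<close>
  then have ends: "iso_tail h = fst" "iso_head h = snd"
    by (auto simp: subgraph_def compatible_def)
  have "(iso_verts h xs, iso_verts h ys) \<in> parcs G" if xy: "(xs, ys) \<in> arcs (hypercube d)" for xs ys
  proof -
    have "iso_arcs h (xs, ys) \<in> parcs G"
      using h(1) xy by (auto simp: subgraph_def)
    moreover have "iso_arcs h (xs, ys) = (iso_verts h xs, iso_verts h ys)"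
      using h(2) xy ends
      by (auto simp: pre_digraph.digraph_isomorphism_def hypercube_def prod_eq_iff)
    ultimately show ?thesis
      by simp
  qed
  then have "?P (iso_verts h)"
    using h by (auto simp: subgraph_def pre_digraph.digraph_isomorphism_def hypercube_def)
  then show "\<exists>\<phi>. ?P \<phi>"
    by (rule exI[of _ "iso_verts h"])
next
  assume "\<exists>\<phi>. ?P \<phi>"
  then obtain \<phi> where \<phi>: "?P \<phi>" ..
  let ?h = "\<lparr>iso_verts = \<phi>, iso_arcs = map_prod \<phi> \<phi>, iso_head = snd, iso_tail = fst\<rparr>"
  have arcs: "arcs (hypercube d) \<subseteq> {xs. length xs = d} \<times> {xs. length xs = d}"
    by (auto simp: hypercube_def)
  have verts: "verts (hypercube d) = {xs. length xs = d}"
    and ends: "tail (hypercube d) = fst" "head (hypercube d) = snd"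
    by (auto simp: hypercube_def)
  have iso: "pre_digraph.digraph_isomorphism (hypercube d) ?h"
    unfolding pre_digraph.digraph_isomorphism_def
    using wf_hypercube \<phi> inj_on_subset[OF map_prod_inj_on arcs, of \<phi> \<phi>]
    by (auto simp: verts ends)
  have "subgraph (app_iso ?h (hypercube d)) (with_proj G)"
    unfolding subgraph_def compatible_def
    using \<phi> wf wf_digraph.wf_digraphI_app_iso[OF wf_hypercube iso]
    by (auto simp: wf_digraph_wp_iff verts)
  then show ?L
    using iso by (auto simp: has_hypercube_def digraph_iso_def)
qed

text \<open>The embedding is composed with \<open>f\<close>. Well-formedness of \<open>G\<close>
  puts the ends of the image arcs in \<open>pverts G\<close>, the only place where \<open>f\<close>
  is known to preserve adjacency.\<close>

lemma pair_iso_has_hypercube: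
  assumes iso: "pair_iso f G H" and wf: "pair_wf_digraph G" "pair_wf_digraph H"
    and "has_hypercube (with_proj G) d"
  shows "has_hypercube (with_proj H) d"
proof -
  obtain \<phi> where \<phi>: "inj_on \<phi> {xs. length xs = d}" "\<phi> ` {xs. length xs = d} \<subseteq> pverts G"
      "\<And>xs ys. (xs, ys) \<in> arcs (hypercube d) \<Longrightarrow> (\<phi> xs, \<phi> ys) \<in> parcs G"
    using assms(4) by (auto simp: has_hypercube_iff[OF wf(1)])
  have f: "inj_on f (pverts G)" "f ` pverts G = pverts H"
      "\<And>x y. x \<in> pverts G \<Longrightarrow> y \<in> pverts G \<Longrightarrow> (f x, f y) \<in> parcs H \<longleftrightarrow> (x, y) \<in> parcs G"
    using iso by (auto simp: pair_iso_def bij_betw_def)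
  have "inj_on (f \<circ> \<phi>) {xs. length xs = d}"
    by (intro comp_inj_on \<phi> inj_on_subset[OF f(1)])
  moreover have "(f \<circ> \<phi>) ` {xs. length xs = d} \<subseteq> pverts H"
    using \<phi>(2) by (auto simp: f(2)[symmetric])
  moreover have "(f (\<phi> xs), f (\<phi> ys)) \<in> parcs H" if "(xs, ys) \<in> arcs (hypercube d)" for xs ys
    using \<phi>(3)[OF that] f(3) pair_wf_digraph.arc_fst_in_verts[OF wf(1) \<phi>(3)[OF that]]
      pair_wf_digraph.arc_snd_in_verts[OF wf(1) \<phi>(3)[OF that]] by simp
  ultimately show ?thesis
    unfolding has_hypercube_iff[OF wf(2)] by (intro exI[of _ "f \<circ> \<phi>"]) auto
qed

lemma pair_iso_inv:
  assumes "pair_iso f G H"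
  shows "pair_iso (inv_into (pverts G) f) H G"
proof -
  have b: "bij_betw f (pverts G) (pverts H)"
    using assms by (simp add: pair_iso_def)
  have "(inv_into (pverts G) f x, inv_into (pverts G) f y) \<in> parcs G \<longleftrightarrow> (x, y) \<in> parcs H"
    if "x \<in> pverts H" "y \<in> pverts H" for x y
    using that assms bij_betw_inv_into_right[OF b] bij_betwE[OF bij_betw_inv_into[OF b]]
    unfolding pair_iso_def by metis
  then show ?thesis
    using bij_betw_inv_into[OF b] by (simp add: pair_iso_def)
qed

lemma pair_iso_kappa:
  assumes "pair_iso f G H" "pair_wf_digraph G" "pair_wf_digraph H"
  shows "kappa (with_proj H) = kappa (with_proj G)"
proof -
  have "has_hypercube (with_proj H) d \<longleftrightarrow> has_hypercube (with_proj G) d" for d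
    using pair_iso_has_hypercube[OF assms]
      pair_iso_has_hypercube[OF pair_iso_inv[OF assms(1)] assms(3,2)] by blast
  then show ?thesis
    by (simp add: kappa_def)
qed

text \<open>The image of the all-\<open>False\<close> string \<open>z\<close> has \<open>d\<close>
  distinct neighbours, namely the images of the strings \<open>e i\<close> that differ from
  \<open>z\<close> in one bit.\<close>

lemma has_hypercube_le_degree:
  assumes wf: "pair_wf_digraph G" and has: "has_hypercube (with_proj G) d"
    and deg: "\<And>v. v \<in> pverts G \<Longrightarrow>
      finite {w. (v, w) \<in> parcs G} \<and> card {w. (v, w) \<in> parcs G} \<le> D"
  shows "d \<le> D"
proof -
  obtain \<phi> where \<phi>: "inj_on \<phi> {xs. length xs = d}" "\<phi> ` {xs. length xs = d} \<subseteq> pverts G"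
      "\<And>xs ys. (xs, ys) \<in> arcs (hypercube d) \<Longrightarrow> (\<phi> xs, \<phi> ys) \<in> parcs G"
    using has by (auto simp: has_hypercube_iff[OF wf])
  define z where "z = replicate d False"
  define e where "e i = z[i := True]" for i
  have e_nth: "j < d \<Longrightarrow> e i ! j \<longleftrightarrow> j = i" for i j
    by (cases "j = i") (simp_all add: e_def z_def)
  have len: "length z = d" "length (e i) = d" for i
    by (simp_all add: e_def z_def)
  have "(z, e i) \<in> arcs (hypercube d)" if "i < d" for i
  proof -
    have "{j. j < d \<and> z ! j \<noteq> e i ! j} = {i}"
      using that by (auto simp: e_nth) (auto simp: z_def)
    then show ?thesis
      by (simp add: hypercube_def len)
  qed
  then have sub: "\<phi> ` e ` {..<d} \<subseteq> {w. (\<phi> z, w) \<in> parcs G}"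
    using \<phi>(3) by auto
  have "inj_on e {..<d}"
    by (rule inj_onI) (metis e_nth lessThan_iff)
  then have "card (\<phi> ` e ` {..<d}) = d"
    by (simp add: card_image inj_on_subset[OF \<phi>(1)] image_subset_iff len)
  moreover have "\<phi> z \<in> pverts G"
    using \<phi>(2) len by auto
  ultimately show ?thesis
    using deg[of "\<phi> z"] card_mono[OF _ sub] by auto
qed

lemma has_hypercube_1I:
  assumes "pair_wf_digraph G" "(a, b) \<in> parcs G" "(b, a) \<in> parcs G" "a \<noteq> b"
  shows "has_hypercube (with_proj G) 1"
proof -
  have ab: "a \<in> pverts G" "b \<in> pverts G"
    using assms(2,3)[THEN pair_wf_digraph.arc_fst_in_verts[OF assms(1)]] by simp_all
  have lists: "{xs :: bool list. length xs = 1} = {[False], [True]}"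
    by (auto simp: length_Suc_conv)
  have "(if hd xs then b else a, if hd ys then b else a) \<in> parcs G"
    if "(xs, ys) \<in> arcs (hypercube 1)" for xs ys
  proof -
    have "xs \<in> {[False], [True]}" "ys \<in> {[False], [True]}" "xs \<noteq> ys"
      using that unfolding lists[symmetric] by (auto simp: hypercube_def)
    then show ?thesis
      using assms by auto
  qed
  then show ?thesis
    unfolding has_hypercube_iff[OF assms(1)] lists using assms(4) ab
    by (intro exI[of _ "\<lambda>xs. if hd xs then b else a"]) auto
qed

lemma length_2_bool_lists:
  "{xs :: bool list. length xs = 2} = {[False, False], [False, True], [True, False], [True, True]}"
  by (auto simp: length_Suc_conv numeral_2_eq_2)

lemma hypercube_2_arcs_iff:
  "([a, b], [c, d]) \<in> arcs (hypercube 2) \<longleftrightarrow> (a \<noteq> c) \<noteq> (b \<noteq> d)"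
proof -
  have "{i. i < 2 \<and> [a, b] ! i \<noteq> [c, d] ! i} =
      (if a \<noteq> c then {0} else {}) \<union> (if b \<noteq> d then {1} else {})"
    by (auto simp: less_2_cases_iff)
  then show ?thesis
    by (auto simp: hypercube_def)
qed

text \<open>The 2-cube is a 4-cycle in which \<open>a\<close> and \<open>d\<close> are opposite
  corners; symmetry supplies the reversed arcs when an embedding is built.\<close>

lemma has_hypercube_2_iff:
  assumes wf: "pair_wf_digraph G" and sym: "sym (parcs G)"
  shows "has_hypercube (with_proj G) 2 \<longleftrightarrow>
    (\<exists>a b c d. distinct [a, b, c, d] \<and> {(a, b), (a, c), (d, b), (d, c)} \<subseteq> parcs G)"
proof
  assume "has_hypercube (with_proj G) 2"
  then obtain \<phi> where \<phi>: "inj_on \<phi> {xs. length xs = 2}"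
      "\<And>xs ys. (xs, ys) \<in> arcs (hypercube 2) \<Longrightarrow> (\<phi> xs, \<phi> ys) \<in> parcs G"
    by (auto simp: has_hypercube_iff[OF wf])
  have "distinct [\<phi> [False, False], \<phi> [False, True], \<phi> [True, False], \<phi> [True, True]]"
    using \<phi>(1) unfolding length_2_bool_lists by (auto simp: inj_on_def)
  then show "\<exists>a b c d. distinct [a, b, c, d] \<and> {(a, b), (a, c), (d, b), (d, c)} \<subseteq> parcs G"
    using \<phi>(2)
    by (intro exI[of _ "\<phi> [False, False]"] exI[of _ "\<phi> [False, True]"] exI[of _ "\<phi> [True, False]"]
        exI[of _ "\<phi> [True, True]"]) (auto simp: hypercube_2_arcs_iff)
next
  assume "\<exists>a b c d. distinct [a, b, c, d] \<and> {(a, b), (a, c), (d, b), (d, c)} \<subseteq> parcs G"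
  then obtain a b c d where dist: "distinct [a, b, c, d]"
    and arcs: "(a, b) \<in> parcs G" "(a, c) \<in> parcs G" "(d, b) \<in> parcs G" "(d, c) \<in> parcs G"
    by auto
  have rev: "(b, a) \<in> parcs G" "(c, a) \<in> parcs G" "(b, d) \<in> parcs G" "(c, d) \<in> parcs G"
    using arcs[THEN symD[OF sym]] by simp_all
  have mem: "{a, b, c, d} \<subseteq> pverts G"
    using arcs[THEN pair_wf_digraph.arc_fst_in_verts[OF wf]]
      arcs[THEN pair_wf_digraph.arc_snd_in_verts[OF wf]] by simp
  define \<phi> where "\<phi> xs = (if xs ! 0 then if xs ! 1 then d else c else if xs ! 1 then b else a)"
    for xs :: "bool list"
  have "(\<phi> xs, \<phi> ys) \<in> parcs G" if xy: "(xs, ys) \<in> arcs (hypercube 2)" for xs ys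
  proof -
    have "length xs = 2" "length ys = 2"
      using xy by (auto simp: hypercube_def)
    then obtain x x' y y' where "xs = [x, x']" "ys = [y, y']"
      by (auto simp: length_Suc_conv numeral_2_eq_2)
    then show ?thesis
      using xy arcs rev by (auto simp: hypercube_2_arcs_iff \<phi>_def)
  qed
  moreover have "inj_on \<phi> {xs. length xs = 2}" "\<phi> ` {xs. length xs = 2} \<subseteq> pverts G"
    using dist mem unfolding length_2_bool_lists by (auto simp: inj_on_def \<phi>_def)
  ultimately show "has_hypercube (with_proj G) 2"
    unfolding has_hypercube_iff[OF wf] by (intro exI[of _ \<phi>]) auto
qed

lemma kappa_eqI:
  assumes "has_hypercube G k" "\<And>d. has_hypercube G d \<Longrightarrow> d \<le> k"
  shows "kappa G = k"
proof -
  have "finite {d. has_hypercube G d}"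
    by (rule finite_subset[of _ "{..k}"]) (use assms(2) in auto)
  then show ?thesis
    unfolding kappa_def by (rule Max_eqI) (simp_all add: assms)
qed

text \<open>For the torus an interval is enough: \<open>ceiling_sqrt_eq_2\<close> only needs the
  dimension to lie between 2 and 4.\<close>

lemma kappa_bounds:
  assumes "has_hypercube G k" "\<And>d. has_hypercube G d \<Longrightarrow> d \<le> D"
  shows "k \<le> kappa G \<and> kappa G \<le> D"
proof -
  have fin: "finite {d. has_hypercube G d}"
    by (rule finite_subset[of _ "{..D}"]) (use assms(2) in auto)
  then show ?thesis
    unfolding kappa_def using assms(1)
    by (intro conjI Max_ge Max.boundedI) (auto intro: assms(2))
qed


text \<open>Three corners of a square form a path whose middle vertex has two neighbours.
  \<open>F\<close> is kept apart from \<open>K\<close> so that one square can be examined inside a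
  larger set.\<close>

lemma square_degree_two:
  assumes "finite K" "F \<subseteq> K" "F \<subseteq> {a, b, c, d}" "3 \<le> card F"
    and sym: "sym (parcs G)" and "distinct [a, b, c, d]"
    and "{(a, b), (a, c), (d, b), (d, c)} \<subseteq> parcs G"
  shows "\<exists>v\<in>K. 2 \<le> card {w \<in> K. (v, w) \<in> parcs G}"
proof -
  \<comment> \<open>Two absent corners would leave at most two elements in \<open>F\<close>.\<close>
  have miss: "p \<in> F \<or> q \<in> F" if "p \<in> {a, b, c, d}" "q \<in> {a, b, c, d}" "p \<noteq> q" for p q
  proof (rule ccontr)
    assume "\<not> (p \<in> F \<or> q \<in> F)"
    then have "card F \<le> card ({a, b, c, d} - {p, q})"
      using assms(3) by (intro card_mono finite_Diff) blast+
    also have "\<dots> = 2"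
      using that assms(6) card_Diff_subset[of "{p, q}" "{a, b, c, d}"] by simp
    finally show False
      using assms(4) by simp
  qed
  have two: "2 \<le> card {w \<in> K. (v, w) \<in> parcs G}"
    if "x \<in> F" "y \<in> F" "x \<noteq> y" "(v, x) \<in> parcs G" "(v, y) \<in> parcs G" for v x y
  proof -
    have "card {x, y} \<le> card {w \<in> K. (v, w) \<in> parcs G}"
      using that assms(1,2) by (intro card_mono) auto
    then show ?thesis
      using that by simp
  qed
  have arcs: "(a, b) \<in> parcs G" "(a, c) \<in> parcs G" "(d, b) \<in> parcs G" "(d, c) \<in> parcs G"
    using assms(7) by auto
  note rev = arcs[THEN symD[OF sym]]
  have "a \<in> F \<or> b \<in> F" "a \<in> F \<or> c \<in> F" "a \<in> F \<or> d \<in> F"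
      "b \<in> F \<or> c \<in> F" "b \<in> F \<or> d \<in> F" "c \<in> F \<or> d \<in> F"
    by (rule miss; use assms(6) in simp)+
  \<comment> \<open>Each case names the middle vertex of the path first.\<close>
  then consider "a \<in> F" "b \<in> F" "c \<in> F" | "d \<in> F" "b \<in> F" "c \<in> F"
    | "b \<in> F" "a \<in> F" "d \<in> F" | "c \<in> F" "a \<in> F" "d \<in> F"
    by blast
  then obtain v where "v \<in> F" "2 \<le> card {w \<in> K. (v, w) \<in> parcs G}"
  proof cases
    case 1
    then show ?thesis
      using that[of a] two[of b c a] arcs assms(6) by simp
  next
    case 2
    then show ?thesis
      using that[of d] two[of b c d] arcs assms(6) by simp
  next
    case 3
    then show ?thesis
      using that[of b] two[of a d b] rev assms(6) by simp
  next
    case 4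
    then show ?thesis
      using that[of c] two[of a d c] rev assms(6) by simp
  qed
  then show ?thesis
    using assms(2) by blast
qed


section \<open>Cycles and tori\<close>

text \<open>The wraparound is spelled out instead of using remainders, which keeps adjacency a
  disjunction of linear conditions.\<close>

definition cycle_graph :: "nat \<Rightarrow> nat pair_pre_digraph" where
  "cycle_graph m =
    \<lparr>pverts = {..<m},
     parcs = {(i, j). i < m \<and> j < m \<and>
       (j = Suc i \<or> i = Suc j \<or> i = 0 \<and> Suc j = m \<or> j = 0 \<and> Suc i = m)}\<rparr>"

definition box_product :: "'a pair_pre_digraph \<Rightarrow> 'b pair_pre_digraph \<Rightarrow> ('a \<times> 'b) pair_pre_digraph"
  where
  "box_product G H =
    \<lparr>pverts = pverts G \<times> pverts H,
     parcs = {((x, y), (x', y')). (x, x') \<in> parcs G \<and> y = y' \<and> y \<in> pverts H \<or>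
       x = x' \<and> x \<in> pverts G \<and> (y, y') \<in> parcs H}\<rparr>"

lemma pverts_cycle_graph [simp]: "pverts (cycle_graph m) = {..<m}"
  by (simp add: cycle_graph_def)

lemma pverts_box_product [simp]: "pverts (box_product G H) = pverts G \<times> pverts H"
  by (simp add: box_product_def)

lemma parcs_cycle_graph_iff:
  "(i, j) \<in> parcs (cycle_graph m) \<longleftrightarrow> i < m \<and> j < m \<and>
    (j = Suc i \<or> i = Suc j \<or> i = 0 \<and> Suc j = m \<or> j = 0 \<and> Suc i = m)"
  by (simp add: cycle_graph_def)

lemma parcs_box_product_iff:
  "((x, y), (x', y')) \<in> parcs (box_product G H) \<longleftrightarrow>
    (x, x') \<in> parcs G \<and> y = y' \<and> y \<in> pverts H \<or> x = x' \<and> x \<in> pverts G \<and> (y, y') \<in> parcs H"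
  by (simp add: box_product_def)

lemma pair_wf_cycle_graph: "pair_wf_digraph (cycle_graph m)"
  by unfold_locales (auto simp: cycle_graph_def)

lemma sym_cycle_graph: "sym (parcs (cycle_graph m))"
  by (auto simp: sym_def parcs_cycle_graph_iff)

lemma pair_wf_box_product:
  assumes "pair_wf_digraph G" "pair_wf_digraph H"
  shows "pair_wf_digraph (box_product G H)"
proof -
  interpret G: pair_wf_digraph G by fact
  interpret H: pair_wf_digraph H by fact
  show ?thesis
    by unfold_locales
      (auto simp: box_product_def dest: G.arc_fst_in_verts G.arc_snd_in_verts
        H.arc_fst_in_verts H.arc_snd_in_verts)
qed

lemma sym_box_product:
  assumes "sym (parcs G)" "sym (parcs H)"
  shows "sym (parcs (box_product G H))"
  using symD[OF assms(1)] symD[OF assms(2)]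
  by (intro symI) (simp only: split_paired_all parcs_box_product_iff, blast)

text \<open>An even cycle is bipartite by parity: the closing edge between \<open>0\<close> and
  \<open>2 * n - 1\<close> also changes parity.\<close>

lemma parcs_cycle_graph_even:
  "(i, j) \<in> parcs (cycle_graph (2 * n)) \<Longrightarrow> even j \<longleftrightarrow> odd i"
  unfolding parcs_cycle_graph_iff by presburger

lemma cycle_graph_neighbours:
  "{j. (i, j) \<in> parcs (cycle_graph m)} \<subseteq>
    {if i = 0 then m - 1 else i - 1, if Suc i = m then 0 else Suc i}"
  by (auto simp: parcs_cycle_graph_iff)

lemma finite_cycle_graph_neighbours: "finite {j. (i, j) \<in> parcs (cycle_graph m)}"
  by (rule finite_subset[OF cycle_graph_neighbours]) simp

lemma card_cycle_graph_neighbours: "card {j. (i, j) \<in> parcs (cycle_graph m)} \<le> 2"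
  by (rule order_trans[OF card_mono[OF _ cycle_graph_neighbours]]) (simp_all add: card_insert_if)

lemma box_product_neighbours:
  "{w. ((x, y), w) \<in> parcs (box_product G H)} \<subseteq>
    (\<lambda>x'. (x', y)) ` {x'. (x, x') \<in> parcs G} \<union> Pair x ` {y'. (y, y') \<in> parcs H}"
  by (auto simp: parcs_box_product_iff)

lemma box_product_degree_le:
  assumes "finite {x'. (x, x') \<in> parcs G} \<and> card {x'. (x, x') \<in> parcs G} \<le> d"
    and "finite {y'. (y, y') \<in> parcs H} \<and> card {y'. (y, y') \<in> parcs H} \<le> e"
  shows "finite {w. ((x, y), w) \<in> parcs (box_product G H)} \<and>
    card {w. ((x, y), w) \<in> parcs (box_product G H)} \<le> d + e"
proof -
  let ?A = "(\<lambda>x'. (x', y)) ` {x'. (x, x') \<in> parcs G}" and ?B = "Pair x ` {y'. (y, y') \<in> parcs H}"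
  have fin: "finite (?A \<union> ?B)"
    using assms by simp
  have "card {w. ((x, y), w) \<in> parcs (box_product G H)} \<le> card (?A \<union> ?B)"
    by (rule card_mono[OF fin box_product_neighbours])
  also have "\<dots> \<le> card ?A + card ?B"
    by (rule card_Un_le)
  also have "\<dots> \<le> d + e"
    using assms card_image_le[of "{x'. (x, x') \<in> parcs G}" "\<lambda>x'. (x', y)"]
      card_image_le[of "{y'. (y, y') \<in> parcs H}" "Pair x"] by linarith
  finally show ?thesis
    using finite_subset[OF box_product_neighbours fin] by simp
qed

section \<open>Hypercube dimension of cycles and tori\<close>

lemma cycle_graph_has_hypercube_le_2:
  "has_hypercube (with_proj (cycle_graph m)) d \<Longrightarrow> d \<le> 2"
  by (rule has_hypercube_le_degree[OF pair_wf_cycle_graph])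
    (simp_all add: finite_cycle_graph_neighbours card_cycle_graph_neighbours)

lemma kappa_cycle_graph_4: "kappa (with_proj (cycle_graph 4)) = 2"
proof (rule kappa_eqI)
  \<comment> \<open>The witnesses come in the order 0, 1, 3, 2 because the first and last must be
    opposite corners.\<close>
  show "has_hypercube (with_proj (cycle_graph 4)) 2"
    unfolding has_hypercube_2_iff[OF pair_wf_cycle_graph sym_cycle_graph]
    by (intro exI[of _ 0] exI[of _ 1] exI[of _ 3] exI[of _ 2]) (simp add: parcs_cycle_graph_iff)
qed (rule cycle_graph_has_hypercube_le_2)

text \<open>In a square, \<open>b\<close> and \<open>c\<close> would have two common neighbours,
  hence be two steps apart along both arcs of the cycle, which forces length 4.\<close>

lemma kappa_cycle_graph:
  assumes "5 \<le> m"
  shows "kappa (with_proj (cycle_graph m)) = 1"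
proof (rule kappa_eqI)
  show "has_hypercube (with_proj (cycle_graph m)) 1"
    using assms by (intro has_hypercube_1I[OF pair_wf_cycle_graph, of 0 1])
      (auto simp: parcs_cycle_graph_iff)
next
  fix d assume d: "has_hypercube (with_proj (cycle_graph m)) d"
  have False if "distinct [a, b, c, e]"
    "{(a, b), (a, c), (e, b), (e, c)} \<subseteq> parcs (cycle_graph m)" for a b c e
  proof -
    \<comment> \<open>Distinct neighbours of \<open>v\<close> lie on its two sides: an interior
      \<open>v\<close>, \<open>v = 0\<close> and \<open>v = m - 1\<close> each give two
      orientations.\<close>
    have ends: "b < m \<and> c < m \<and> (b = Suc v \<and> v = Suc c \<or> c = Suc v \<and> v = Suc b \<or>
        v = 0 \<and> b = 1 \<and> Suc c = m \<or> v = 0 \<and> c = 1 \<and> Suc b = m \<or>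
        Suc v = m \<and> b = 0 \<and> v = Suc c \<or> Suc v = m \<and> c = 0 \<and> v = Suc b)"
      if "(v, b) \<in> parcs (cycle_graph m)" "(v, c) \<in> parcs (cycle_graph m)" for v
      using that \<open>distinct [a, b, c, e]\<close> unfolding parcs_cycle_graph_iff
      by (elim conjE disjE) simp_all
    have "a \<noteq> e"
      using that(1) by auto
    moreover note ends[of a] ends[of e]
    ultimately show False
      using that(2) assms unfolding insert_subset by (elim conjE disjE) linarith+
  qed
  then have "d \<noteq> 2"
    using d has_hypercube_2_iff[OF pair_wf_cycle_graph sym_cycle_graph] by blast
  then show "d \<le> 1"
    using cycle_graph_has_hypercube_le_2[OF d] by simp
qed

lemma kappa_torus:
  assumes "2 \<le> m" "2 \<le> m'"
  shows "2 \<le> kappa (with_proj (box_product (cycle_graph m) (cycle_graph m'))) \<and>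
    kappa (with_proj (box_product (cycle_graph m) (cycle_graph m'))) \<le> 4"
proof (rule kappa_bounds)
  show "has_hypercube (with_proj (box_product (cycle_graph m) (cycle_graph m'))) 2"
    unfolding has_hypercube_2_iff[OF pair_wf_box_product[OF pair_wf_cycle_graph pair_wf_cycle_graph]
        sym_box_product[OF sym_cycle_graph sym_cycle_graph]]
    using assms
    by (intro exI[of _ "(0, 0)"] exI[of _ "(1, 0)"] exI[of _ "(0, 1)"] exI[of _ "(1, 1)"])
      (simp add: parcs_box_product_iff parcs_cycle_graph_iff)
next
  fix d assume "has_hypercube (with_proj (box_product (cycle_graph m) (cycle_graph m'))) d"
  then show "d \<le> 4"
  proof (rule has_hypercube_le_degree[OF pair_wf_box_product[OF pair_wf_cycle_graph pair_wf_cycle_graph]])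
    fix v :: "nat \<times> nat"
    show "finite {w. (v, w) \<in> parcs (box_product (cycle_graph m) (cycle_graph m'))} \<and>
      card {w. (v, w) \<in> parcs (box_product (cycle_graph m) (cycle_graph m'))} \<le> 4"
      using box_product_degree_le[of "fst v" "cycle_graph m" 2 "snd v" "cycle_graph m'" 2]
      by (simp add: finite_cycle_graph_neighbours card_cycle_graph_neighbours)
  qed
qed

text \<open>A pigeonhole principle; its contrapositive later finds a crowded 2 by 2 block of the
  torus.\<close>

lemma card_le_fibres:
  assumes "finite A" "f ` A \<subseteq> B" "finite B" "\<And>b. b \<in> B \<Longrightarrow> card {a \<in> A. f a = b} \<le> c"
  shows "card A \<le> c * card B"
proof -
  have "A = (\<Union>b\<in>B. {a \<in> A. f a = b})"
    using assms(2) by auto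
  then have "card A \<le> (\<Sum>b\<in>B. card {a \<in> A. f a = b})"
    using card_UN_le[OF assms(3), of "\<lambda>b. {a \<in> A. f a = b}"] by simp
  also have "\<dots> \<le> (\<Sum>b\<in>B. c)"
    by (rule sum_mono) (rule assms(4))
  finally show ?thesis
    by (simp add: mult.commute)
qed

section \<open>Independence numbers of even cycles and tori\<close>

lemma independence_number_cycle_graph:
  assumes "1 \<le> n"
  shows "independence_number (with_proj (cycle_graph (2 * n))) = n"
proof (rule independence_number_eqI)
  have "(2 * i, 2 * j) \<notin> parcs (cycle_graph (2 * n))" for i j
    using parcs_cycle_graph_even[of "2 * i" "2 * j" n] by auto
  then show "independent_set (with_proj (cycle_graph (2 * n))) ((\<lambda>k. 2 * k) ` {..<n})"
    by (auto simp: independent_set_def)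
  show "card ((\<lambda>k. 2 * k) ` {..<n}) = n"
    by (simp add: card_image inj_on_def)
next
  fix B assume B: "independent_set (with_proj (cycle_graph (2 * n))) B"
  then have sub: "B \<subseteq> {..<2 * n}"
    by (simp add: independent_set_def)
  \<comment> \<open>The edges joining \<open>2 * k\<close> and \<open>2 * k + 1\<close> form a
    perfect matching, and an independent set uses at most one end of each of these \<open>n\<close>
    edges.\<close>
  have "inj_on (\<lambda>i. i div 2) B"
  proof (rule inj_onI)
    fix i j assume ij: "i \<in> B" "j \<in> B" "i div 2 = j div 2"
    then have "i = j \<or> i = Suc j \<or> j = Suc i"
      by presburger
    moreover have "(i, j) \<notin> parcs (cycle_graph (2 * n))"
      using B ij by (simp add: independent_set_def)
    ultimately show "i = j"
      using sub ij by (auto simp: parcs_cycle_graph_iff)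
  qed
  moreover have "(\<lambda>i. i div 2) ` B \<subseteq> {..<n}"
    using sub by auto
  ultimately have "card B \<le> card {..<n}"
    by (intro card_inj_on_le) auto
  then show "card B \<le> n"
    by simp
qed simp

text \<open>An edge moves exactly one coordinate, along an even cycle, so it flips the parity of the
  sum.\<close>

lemma torus_arc_parity:
  assumes "((x, y), (x', y')) \<in> parcs (box_product (cycle_graph (2 * n)) (cycle_graph (2 * n')))"
  shows "even (x' + y') \<longleftrightarrow> odd (x + y)"
  using assms parcs_cycle_graph_even[of x x' n] parcs_cycle_graph_even[of y y' n']
  by (auto simp: parcs_box_product_iff)

lemma card_even_torus_vertices:
  "card {(x, y). x < 2 * n \<and> y < 2 * n' \<and> even (x + y)} = 2 * n * (n' :: nat)"
proof -
  \<comment> \<open>In row \<open>y\<close>, each pair \<open>2 * k\<close>,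
    \<open>2 * k + 1\<close> contains exactly one abscissa of the parity of \<open>y\<close>, so
    every row contributes \<open>n\<close> vertices.\<close>
  let ?h = "\<lambda>(k, y). (2 * k + y mod 2, y)"
  have "{(x, y). x < 2 * n \<and> y < 2 * n' \<and> even (x + y)} = ?h ` ({..<n} \<times> {..<2 * n'})"
  proof (intro equalityI subsetI)
    fix v assume "v \<in> {(x, y). x < 2 * n \<and> y < 2 * n' \<and> even (x + y)}"
    then obtain x y where v: "v = (x, y)" "x < 2 * n" "y < 2 * n'" "even (x + y)"
      by auto
    have "x = 2 * (x div 2) + y mod 2"
      using v(4) by presburger
    then have "v = ?h (x div 2, y)"
      using v(1) by simp
    moreover have "(x div 2, y) \<in> {..<n} \<times> {..<2 * n'}"
      using v by auto
    ultimately show "v \<in> ?h ` ({..<n} \<times> {..<2 * n'})"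
      by (rule image_eqI)
  next
    fix v assume "v \<in> ?h ` ({..<n} \<times> {..<2 * n'})"
    then obtain k y where v: "v = (2 * k + y mod 2, y)" "k < n" "y < 2 * n'"
      by auto
    have "2 * k + y mod 2 < 2 * n" "even (2 * k + y mod 2 + y)"
      using v(2) by presburger+
    then show "v \<in> {(x, y). x < 2 * n \<and> y < 2 * n' \<and> even (x + y)}"
      using v by simp
  qed
  moreover have "inj_on ?h ({..<n} \<times> {..<2 * n'})"
    by (auto simp: inj_on_def)
  ultimately show ?thesis
    by (simp add: card_image)
qed

lemma independence_number_torus:
  fixes n n' :: nat
  assumes "1 \<le> n" "1 \<le> n'"
  shows "independence_number (with_proj (box_product (cycle_graph (2 * n)) (cycle_graph (2 * n')))) =
    2 * n * n'"
    (is "independence_number (with_proj ?T) = _")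
proof (rule independence_number_eqI)
  let ?E = "{(x, y). x < 2 * n \<and> y < 2 * n' \<and> even (x + y)}"
  have "(v, w) \<notin> parcs ?T" if "v \<in> ?E" "w \<in> ?E" for v w
    using that torus_arc_parity[of "fst v" "snd v" "fst w" "snd w" n n'] by auto
  then show "independent_set (with_proj ?T) ?E"
    by (auto simp: independent_set_def)
  show "card ?E = 2 * n * n'"
    by (rule card_even_torus_vertices)
next
  fix B assume B: "independent_set (with_proj ?T) B"
  then have sub: "B \<subseteq> {..<2 * n} \<times> {..<2 * n'}"
    by (simp add: independent_set_def)
  \<comment> \<open>The perfect matching of the cycle is repeated in each of the
    \<open>2 * n'\<close> rows; an independent set meets each matching edge at most once.\<close>
  have "inj_on (\<lambda>(x, y). (x div 2, y)) B"
  proof (rule inj_onI)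
    fix v w assume vw: "v \<in> B" "w \<in> B" "(\<lambda>(x, y). (x div 2, y)) v = (\<lambda>(x, y). (x div 2, y)) w"
    obtain x y x' where v: "v = (x, y)" "w = (x', y)" "x div 2 = x' div 2"
      using vw(3) by (cases v, cases w) auto
    then have "x = x' \<or> x = Suc x' \<or> x' = Suc x"
      by presburger
    moreover have "(v, w) \<notin> parcs ?T"
      using B vw by (simp add: independent_set_def)
    moreover have "x < 2 * n" "x' < 2 * n" "y < 2 * n'"
      using sub vw v by auto
    ultimately show "v = w"
      using v by (auto simp: parcs_box_product_iff parcs_cycle_graph_iff)
  qed
  moreover have "(\<lambda>(x, y). (x div 2, y)) ` B \<subseteq> {..<n} \<times> {..<2 * n'}"
    using sub by auto
  ultimately have "card B \<le> card ({..<n} \<times> {..<2 * n'})"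
    by (intro card_inj_on_le) auto
  then show "card B \<le> 2 * n * n'"
    by simp
qed simp

section \<open>Induced degrees in sets larger than the independence number\<close>

lemma ex_arc_if_gt_independence_number:
  assumes "finite (pverts G)" "L \<subseteq> pverts G" "independence_number (with_proj G) < card L"
  shows "\<exists>v\<in>L. 1 \<le> card {w \<in> L. (v, w) \<in> parcs G}"
proof -
  \<comment> \<open>A set this large spans an edge; this is the lower bound 1 used for the longer
    cycles.\<close>
  have "\<not> independent_set (with_proj G) L"
    using card_le_independence_number[of "with_proj G" L] assms by auto
  then obtain v w where vw: "v \<in> L" "w \<in> L" "(v, w) \<in> parcs G"
    using assms(2) by (auto simp: independent_set_def)
  moreover have "finite L"
    using assms finite_subset by blast
  ultimately have "card {w \<in> L. (v, w) \<in> parcs G} \<noteq> 0"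
    by auto
  then show ?thesis
    using vw(1) by (intro bexI[of _ v]) auto
qed

text \<open>The whole vertex set serves as the witness, and any three vertices already contain a
  path of length two.\<close>

lemma sigma_cycle_graph_4: "sigma (with_proj (cycle_graph 4)) = 2"
proof (rule sigma_eqI)
  have alpha: "independence_number (with_proj (cycle_graph 4)) = 2"
    using independence_number_cycle_graph[of 2] by simp
  show "independence_number (with_proj (cycle_graph 4)) < card {..<4 :: nat}"
    by (simp add: alpha)
  show "card {w \<in> {..<4}. (v, w) \<in> parcs (cycle_graph 4)} \<le> 2" for v
    by (rule order_trans[OF card_mono card_cycle_graph_neighbours[of v 4]])
      (auto simp: finite_cycle_graph_neighbours)
  show "\<exists>v\<in>L. 2 \<le> card {w \<in> L. (v, w) \<in> parcs (cycle_graph 4)}"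
    if "L \<subseteq> pverts (cycle_graph 4)" "independence_number (with_proj (cycle_graph 4)) < card L" for L
  proof (rule square_degree_two[of L L 0 1 3 2])
    show "finite L"
      using that(1) finite_subset by auto
    have "{..<4 :: nat} = {0, 1, 3, 2}"
      by auto
    then show "L \<subseteq> {0, 1, 3, 2}"
      using that(1) by simp
    show "3 \<le> card L"
      using that(2) alpha by simp
  qed (simp_all add: sym_cycle_graph parcs_cycle_graph_iff)
qed simp_all

lemma sigma_cycle_graph:
  assumes "3 \<le> n"
  shows "sigma (with_proj (cycle_graph (2 * n))) = 1"
proof -
  let ?E = "(\<lambda>k. 2 * k) ` {..<n} :: nat set"
  \<comment> \<open>The only edges inside \<open>?K\<close> are 0-1 and 3-4. The assumption
    \<open>3 \<le> n\<close> makes 4 a vertex distinct from 0; for \<open>n = 2\<close> the vertex 0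
    would be joined to both 1 and 3.\<close>
  let ?K = "insert 1 (insert 3 (?E - {2}))"
  have alpha: "independence_number (with_proj (cycle_graph (2 * n))) = n"
    using assms by (intro independence_number_cycle_graph) simp
  have "2 \<in> ?E"
    using assms by (intro image_eqI[of _ _ 1]) auto
  moreover have "1 \<notin> ?E" "3 \<notin> ?E"
    by (auto, presburger+)
  moreover have "card ?E = n"
    by (simp add: card_image inj_on_def)
  ultimately have card: "card ?K = Suc n"
    using assms by (simp add: card_insert_if)
  have K_sub: "?K \<subseteq> {..<2 * n}"
    using assms by auto
  have "card {w \<in> ?K. (v, w) \<in> parcs (cycle_graph (2 * n))} \<le> 1" if v: "v \<in> ?K" for v
  proof -
    \<comment> \<open>The sole candidate neighbour of \<open>v\<close>. The final value 3 is correct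
      for \<open>v = 4\<close> and vacuous for the larger even vertices, which are isolated in
      \<open>?K\<close>.\<close>
    have "w = (if v = 0 then 1 else if v = 1 then 0 else if v = 3 then 4 else 3)"
      if "w \<in> ?K" "(v, w) \<in> parcs (cycle_graph (2 * n))" for w
    proof -
      have K: "u = 1 \<or> u = 3 \<or> even u \<and> u \<noteq> 2" if "u \<in> ?K" for u
        using that by auto
      have parity: "even w \<longleftrightarrow> odd v"
        using that(2) by (rule parcs_cycle_graph_even)
      show ?thesis
      proof (cases "odd v")
        case True
        then have "v = 1 \<or> v = 3" "w \<noteq> 2"
          using K[OF v] K[OF that(1)] parity by auto
        then have "v = 1 \<and> w = 0 \<or> v = 3 \<and> w = 4"
          using that(2) assms unfolding parcs_cycle_graph_iff by linarith
        then show ?thesis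
          by auto
      next
        case False
        then have "w = 1 \<or> w = 3" "v \<noteq> 2"
          using K[OF v] K[OF that(1)] parity by auto
        then have "v = 0 \<and> w = 1 \<or> v \<noteq> 0 \<and> v \<noteq> 1 \<and> v \<noteq> 3 \<and> w = 3"
          using that(2) assms False unfolding parcs_cycle_graph_iff by auto
        then show ?thesis
          by auto
      qed
    qed
    then have "{w \<in> ?K. (v, w) \<in> parcs (cycle_graph (2 * n))} \<subseteq>
        {if v = 0 then 1 else if v = 1 then 0 else if v = 3 then 4 else 3}"
      by blast
    from card_mono[OF _ this] show ?thesis
      by simp
  qed
  then show ?thesis
    using alpha card K_sub ex_arc_if_gt_independence_number[of "cycle_graph (2 * n)"]
    by (intro sigma_eqI[of _ ?K]) simp_all
qed

lemma torus_degree_two: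
  fixes n n' :: nat
  assumes L: "L \<subseteq> {..<2 * n} \<times> {..<2 * n'}" and card: "2 * n * n' < card L"
  shows "\<exists>v\<in>L. 2 \<le> card {w \<in> L. (v, w) \<in> parcs (box_product (cycle_graph (2 * n)) (cycle_graph (2 * n')))}"
    (is "\<exists>v\<in>L. 2 \<le> card {w \<in> L. (v, w) \<in> parcs ?T}")
proof -
  \<comment> \<open>\<open>?f\<close> sends a vertex to the index of its 2 by 2 block.\<close>
  let ?f = "\<lambda>(x, y). (x div 2, y div 2) :: nat \<times> nat"
  have fin: "finite L"
    using L finite_subset by blast
  \<comment> \<open>With at most two vertices in each of the \<open>n * n'\<close> blocks,
    \<open>L\<close> could not exceed \<open>2 * n * n'\<close>.\<close>
  have "\<exists>b \<in> {..<n} \<times> {..<n'}. 3 \<le> card {v \<in> L. ?f v = b}"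
  proof (rule ccontr)
    assume none: "\<not> ?thesis"
    have "card {v \<in> L. ?f v = b} \<le> 2" if "b \<in> {..<n} \<times> {..<n'}" for b
    proof -
      have "\<not> 3 \<le> card {v \<in> L. ?f v = b}"
        using none that by blast
      then show ?thesis
        by simp
    qed
    moreover have "?f ` L \<subseteq> {..<n} \<times> {..<n'}"
      using L by auto
    ultimately have "card L \<le> 2 * card ({..<n} \<times> {..<n'})"
      by (intro card_le_fibres[OF fin]) auto
    then show False
      using card by simp
  qed
  then obtain i j where ij: "i < n" "j < n'" "3 \<le> card {v \<in> L. ?f v = (i, j)}"
    by auto
  have "v \<in> {(2 * i, 2 * j), (Suc (2 * i), 2 * j), (2 * i, Suc (2 * j)), (Suc (2 * i), Suc (2 * j))}"
    if f: "?f v = (i, j)" for v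
  proof -
    obtain x y where v: "v = (x, y)" "x div 2 = i" "y div 2 = j"
      using f by (cases v) auto
    then have "x = 2 * i \<or> x = Suc (2 * i)" "y = 2 * j \<or> y = Suc (2 * j)"
      by presburger+
    then show ?thesis
      using v(1) by auto
  qed
  then have "{v \<in> L. ?f v = (i, j)} \<subseteq>
      {(2 * i, 2 * j), (Suc (2 * i), 2 * j), (2 * i, Suc (2 * j)), (Suc (2 * i), Suc (2 * j))}"
    by blast
  then show ?thesis
    using fin ij
    by (intro square_degree_two[where F = "{v \<in> L. ?f v = (i, j)}" and a = "(2 * i, 2 * j)" and
          b = "(Suc (2 * i), 2 * j)" and c = "(2 * i, Suc (2 * j))" and
          d = "(Suc (2 * i), Suc (2 * j))"])
      (simp_all add: sym_box_product sym_cycle_graph parcs_box_product_iff parcs_cycle_graph_iff)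
qed

text \<open>
  Take the vertices of even coordinate sum, a maximum independent set, and replace the even vertices
  on the cross \<open>x = 0 \<or> y = 0\<close> by the odd ones. The cross has one more odd vertex than even
  ones, as \<open>(0, 0)\<close> is even and lies on both axes. This adapts the vertex sets of Chung, Furedi,
  Graham and Seymour for the hypercube.
\<close>

definition torus_witness :: "nat \<Rightarrow> nat \<Rightarrow> (nat \<times> nat) set" where
  "torus_witness m m' =
    {(x, y). x < m \<and> y < m' \<and> (if x = 0 \<or> y = 0 then odd (x + y) else even (x + y))}"

lemma card_torus_witness:
  fixes n n' :: nat
  assumes "1 \<le> n" "1 \<le> n'"
  shows "2 * n * n' < card (torus_witness (2 * n) (2 * n'))"
proof -
  let ?E = "{(x, y). x < 2 * n \<and> y < 2 * n' \<and> even (x + y)}"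
  let ?K = "torus_witness (2 * n) (2 * n')"
  \<comment> \<open>Even vertices on the axes are shifted one step along their axis. The origin is
    sent to \<open>(0, 1)\<close>, so \<open>(1, 0)\<close> is left uncovered, which gives the
    strict inequality.\<close>
  let ?h = "\<lambda>(x, y). if x = 0 then (0, Suc y) else if y = 0 then (Suc x, 0) else (x, y)"
  have fin: "finite ?K"
    by (rule finite_subset[of _ "{..<2 * n} \<times> {..<2 * n'}"]) (auto simp: torus_witness_def)
  have inj: "inj_on ?h ?E"
    by (auto simp: inj_on_def split: if_splits)
  have maps: "?h v \<in> ?K - {(1, 0)}" if v: "v \<in> ?E" for v
  proof -
    obtain x y where xy: "v = (x, y)" "x < 2 * n" "y < 2 * n'" "even (x + y)"
      using v by auto
    \<comment> \<open>The shift does not leave the range: an even number below an even bound is at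
      least two below it.\<close>
    have "x = 0 \<Longrightarrow> Suc y < 2 * n'" "y = 0 \<Longrightarrow> Suc x < 2 * n"
      using xy(2-4) by simp_all presburger+
    then show ?thesis
      using xy by (auto simp: torus_witness_def)
  qed
  have "card ?E \<le> card (?K - {(1, 0)})"
    by (rule card_inj_on_le[OF inj image_subsetI[OF maps] finite_Diff[OF fin]])
  moreover have "(1, 0) \<in> ?K"
    using assms by (simp add: torus_witness_def)
  then have "card (?K - {(1, 0)}) < card ?K"
    by (rule card_Diff1_less[OF fin])
  ultimately show ?thesis
    unfolding card_even_torus_vertices by linarith
qed

text \<open>Both the parity of an edge's ends and the parity required on and off the axes differ, so
  an edge inside the set joins an axis vertex to an off-axis one. An off-axis \<open>(x, y)\<close>
  can reach only \<open>(0, y)\<close> and \<open>(x, 0)\<close>; an axis vertex can only step off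
  its axis, in two directions.\<close>

lemma torus_witness_degree_le_2:
  fixes n n' :: nat
  assumes n: "2 \<le> n" "2 \<le> n'" and v: "v \<in> torus_witness (2 * n) (2 * n')"
  shows "card {w \<in> torus_witness (2 * n) (2 * n').
    (v, w) \<in> parcs (box_product (cycle_graph (2 * n)) (cycle_graph (2 * n')))} \<le> 2"
    (is "card ?N \<le> 2")
proof -
  obtain x y where xy: "v = (x, y)"
    by (cases v)
  have N: "?N \<subseteq> (if x = 0 then {(1, y), (2 * n - 1, y)} else
      if y = 0 then {(x, 1), (x, 2 * n' - 1)} else {(0, y), (x, 0)})"
  proof
    fix w assume w: "w \<in> ?N"
    obtain x' y' where w_eq: "w = (x', y')"
      by (cases w)
    have "even (x' + y') \<longleftrightarrow> odd (x + y)"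
      using w xy w_eq torus_arc_parity by blast
    then have cross: "(x' = 0 \<or> y' = 0) \<longleftrightarrow> x \<noteq> 0 \<and> y \<noteq> 0"
      using v w xy w_eq by (auto simp: torus_witness_def split: if_splits)
    have step: "(x, x') \<in> parcs (cycle_graph (2 * n)) \<and> y = y' \<or>
        x = x' \<and> (y, y') \<in> parcs (cycle_graph (2 * n'))"
      using w xy w_eq by (auto simp: parcs_box_product_iff)
    show "w \<in> (if x = 0 then {(1, y), (2 * n - 1, y)} else
      if y = 0 then {(x, 1), (x, 2 * n' - 1)} else {(0, y), (x, 0)})"
      using step cross by (auto simp: w_eq parcs_cycle_graph_iff)
  qed
  have "card ?N \<le> card (if x = 0 then {(1, y), (2 * n - 1, y)} else
      if y = 0 then {(x, 1), (x, 2 * n' - 1)} else {(0, y), (x, 0)})"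
    by (rule card_mono[OF _ N]) simp
  also have "\<dots> \<le> 2"
    by (simp add: card_insert_if)
  finally show ?thesis .
qed

lemma sigma_torus:
  fixes n n' :: nat
  assumes "2 \<le> n" "2 \<le> n'"
  shows "sigma (with_proj (box_product (cycle_graph (2 * n)) (cycle_graph (2 * n')))) = 2"
proof -
  have "independence_number (with_proj (box_product (cycle_graph (2 * n)) (cycle_graph (2 * n')))) =
      2 * n * n'"
    using assms by (intro independence_number_torus) auto
  moreover have "torus_witness (2 * n) (2 * n') \<subseteq> {..<2 * n} \<times> {..<2 * n'}"
    by (auto simp: torus_witness_def)
  ultimately show ?thesis
    using assms card_torus_witness[of n n'] torus_witness_degree_le_2[of n n'] torus_degree_two
    by (intro sigma_eqI[of _ "torus_witness (2 * n) (2 * n')"]) simp_all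
qed


section \<open>The Cayley graphs\<close>

text \<open>
  The generators act on the integers by the two matchings of the infinite path: \<open>s\<close> swaps \<open>2i\<close> and
  \<open>2i + 1\<close>, and \<open>t\<close> swaps \<open>2i - 1\<close> and \<open>2i\<close>. The relator \<open>(st)\<^sup>n\<close> moves every integer by
  \<open>\<plusminus>2n\<close>, so the position reached from \<open>0\<close>, taken modulo \<open>2n\<close>, is an invariant of group elements.
\<close>

primrec dihedral_step :: "dihedral_gen \<Rightarrow> int \<Rightarrow> int" where
  "dihedral_step gen_s k = (if even k then k + 1 else k - 1)"
| "dihedral_step gen_t k = (if even k then k - 1 else k + 1)"

text \<open>Exponents are ignored since each step is an involution. The leftmost letter acts first,
  so right multiplication by a generator is one further step, as along a Cayley edge.\<close>

definition dihedral_act :: "dihedral_gen group_word \<Rightarrow> int \<Rightarrow> int" where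
  "dihedral_act u = fold (\<lambda>(x, b). dihedral_step x) u"

lemma dihedral_act_simps [simp]:
  "dihedral_act [] k = k"
  "dihedral_act ((x, b) # u) k = dihedral_act u (dihedral_step x k)"
  "dihedral_act (u @ v) k = dihedral_act v (dihedral_act u k)"
  by (simp_all add: dihedral_act_def)

lemma dihedral_step_step [simp]: "dihedral_step x (dihedral_step x k) = k"
  by (cases x) simp_all

lemma even_cong:
  fixes k l :: int
  assumes "[k = l] (mod 2 * int n)"
  shows "even k \<longleftrightarrow> even l"
  using cong_modulus_mult[OF assms] by (simp add: cong_def even_iff_mod_2_eq_zero)

text \<open>The modulus is even, so the residue determines the parity and with it the direction of
  the step.\<close>

lemma dihedral_step_cong:
  assumes "[k = l] (mod 2 * int n)"
  shows "[dihedral_step x k = dihedral_step x l] (mod 2 * int n)"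
  using assms even_cong[OF assms] by (cases x) (auto intro: cong_add cong_diff)

lemma dihedral_act_cong:
  "[k = l] (mod 2 * int n) \<Longrightarrow> [dihedral_act u k = dihedral_act u l] (mod 2 * int n)"
proof (induction u arbitrary: k l)
  case (Cons a u)
  then show ?case
    by (cases a) (simp add: dihedral_step_cong)
qed simp

lemma dihedral_act_relator:
  "dihedral_act (concat (replicate m [(gen_s, True), (gen_t, True)])) k =
    (if even k then k + 2 * int m else k - 2 * int m)"
  by (induction m arbitrary: k) simp_all

text \<open>Each defining rule preserves the endpoint modulo \<open>2 * n\<close>. The starting
  point is arbitrary because a relator may occur after any prefix.\<close>

lemma dihedral_act_pres_eq:
  "pres_eq (I2_relators n) u v \<Longrightarrow> [dihedral_act u k = dihedral_act v k] (mod 2 * int n)"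
proof (induction arbitrary: k rule: pres_eq.induct)
  case (sym u v)
  then show ?case
    by (simp add: cong_sym)
next
  case (trans u v w)
  then show ?case
    using cong_trans by blast
next
  case (relator r u v)
  have "[dihedral_act r l = l] (mod 2 * int n)" for l
    using relator by (auto simp: I2_relators_def dihedral_act_relator cong_iff_dvd_diff)
  then show ?case
    by (simp add: dihedral_act_cong)
qed simp_all

text \<open>These words, for lengths below \<open>2 * n\<close>, are the normal forms: the word of
  length \<open>k\<close> walks from \<open>0\<close> to \<open>k\<close>.\<close>

primrec alt_word :: "nat \<Rightarrow> dihedral_gen group_word" where
  "alt_word 0 = []"
| "alt_word (Suc k) = alt_word k @ [(if even k then gen_s else gen_t, True)]"

lemma dihedral_act_alt_word: "dihedral_act (alt_word k) 0 = int k"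
  by (induction k) simp_all

lemma alt_word_double:
  "alt_word (2 * k) = concat (replicate k [(gen_s, True), (gen_t, True)])"
proof (induction k)
  case (Suc k)
  \<comment> \<open>\<open>replicate\<close> unfolds at the front while \<open>alt_word\<close>
    grows at the back; a power of a word commutes with the word.\<close>
  have "concat (replicate k w) @ w = w @ concat (replicate k w)" for w :: "dihedral_gen group_word"
    by (induction k) simp_all
  from this[of "[(gen_s, True), (gen_t, True)]"] show ?case
    using Suc by simp
qed simp

section \<open>Normal forms and the word problem in the dihedral group\<close>

locale dihedral =
  fixes n :: nat
  assumes n: "1 \<le> n"
begin

abbreviation deq :: "dihedral_gen group_word \<Rightarrow> dihedral_gen group_word \<Rightarrow> bool"
    (infix \<open>\<approx>\<close> 50) where
  "u \<approx> v \<equiv> pres_eq (I2_relators n) u v"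

lemma deq_square: "u @ [(x, True), (x, True)] \<approx> u"
  using pres_eq.relator[of "[(x, True), (x, True)]" "I2_relators n" u "[]"]
  by (cases x) (simp_all add: I2_relators_def)

text \<open>Generators are involutions: the inverse of \<open>x\<close> equals the inverse of
  \<open>x\<close> times \<open>x x\<close>, which is \<open>x\<close>.\<close>

lemma deq_letter: "[(x, b)] \<approx> [(x, True)]"
proof (cases b)
  case False
  have "[(x, False)] @ [(x, True), (x, True)] \<approx> [(x, True)]"
    using pres_eq.cancel[of "I2_relators n" "[]" x False "[(x, True)]"] by simp
  then show ?thesis
    using False pres_eq.trans[OF pres_eq.sym[OF deq_square[of "[(x, False)]" x]]] by simp
qed (simp add: pres_eq.refl)

lemma alt_word_period: "alt_word (2 * n) \<approx> []"
  using pres_eq.relator[of "alt_word (2 * n)" "I2_relators n" "[]" "[]"]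
  by (simp add: alt_word_double I2_relators_def)

text \<open>Right multiplication of a normal form: the letter next in turn lengthens the word, the
  other one cancels its last letter. The exceptions are the two ends, where the relator of length
  \<open>2 * n\<close> wraps the position round.\<close>

lemma alt_word_append:
  assumes "k < 2 * n"
  shows "alt_word k @ [(x, True)] \<approx> alt_word (nat (dihedral_step x (int k) mod (2 * int n)))"
proof (cases "x = (if even k then gen_s else gen_t)")
  case True
  then have w: "alt_word k @ [(x, True)] = alt_word (Suc k)"
    by simp
  have step: "dihedral_step x (int k) = int (Suc k)"
    using True by (simp split: if_splits)
  show ?thesis
  proof (cases "Suc k = 2 * n")
    case True
    then have "nat (dihedral_step x (int k) mod (2 * int n)) = 0"
      unfolding step by simp
    then show ?thesis
      using alt_word_period True w by simp
  next
    case False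
    then have "int (Suc k) mod (2 * int n) = int (Suc k)"
      using assms by (intro mod_pos_pos_trivial) auto
    then show ?thesis
      unfolding step w by (simp only: nat_int pres_eq.refl)
  qed
next
  case False
  show ?thesis
  proof (cases k)
    case 0
    then have x: "x = gen_t"
      using False by (cases x) auto
    obtain m where m: "2 * n = Suc m"
      using n by (cases "2 * n") auto
    have "odd m"
      using m by presburger
    \<comment> \<open>As \<open>m = 2 * n - 1\<close> is odd, the long relator ends in
      \<open>gen_t\<close>; cancelling that letter identifies \<open>gen_t\<close> with the word of
      length \<open>m\<close>.\<close>
    then have "alt_word m @ [(x, True)] = alt_word (2 * n)"
      by (simp add: m x)
    then have "alt_word m @ [(x, True), (x, True)] \<approx> [(x, True)]"
      using pres_eq_append_right[OF alt_word_period, of "[(x, True)]"]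
      by (metis append.left_neutral append_Cons append_assoc)
    then have "[(x, True)] \<approx> alt_word m"
      by (rule pres_eq.trans[OF pres_eq.sym deq_square])
    moreover have "nat (dihedral_step x (int k) mod (2 * int n)) = m"
    proof -
      have "(- 1 :: int) mod (2 * int n) = 2 * int n - 1"
        using n by (simp add: zmod_minus1)
      then show ?thesis
        using m 0 x by (simp add: nat_eq_iff)
    qed
    ultimately show ?thesis
      by (simp add: 0)
  next
    case (Suc l)
    then have x: "x = (if even l then gen_s else gen_t)"
      using False by (cases x) (auto split: if_splits)
    then have step: "dihedral_step x (int k) = int l"
      using Suc by auto
    have "alt_word k @ [(x, True)] \<approx> alt_word l"
      using deq_square[of "alt_word l" x] Suc x by simp
    moreover have "int l mod (2 * int n) = int l"
      using assms Suc by (intro mod_pos_pos_trivial) auto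
    ultimately show ?thesis
      unfolding step by simp
  qed
qed

definition word_pos :: "dihedral_gen group_word \<Rightarrow> nat" where
  "word_pos u = nat (dihedral_act u 0 mod (2 * int n))"

lemma word_pos_less: "word_pos u < 2 * n"
  using n pos_mod_bound[of "2 * int n" "dihedral_act u 0"] by (simp add: word_pos_def nat_less_iff)

lemma int_word_pos: "int (word_pos u) = dihedral_act u 0 mod (2 * int n)"
  using n by (simp add: word_pos_def)

lemma word_pos_snoc: "word_pos (u @ [(x, b)]) = nat (dihedral_step x (int (word_pos u)) mod (2 * int n))"
proof -
  have "[dihedral_step x (dihedral_act u 0) = dihedral_step x (int (word_pos u))] (mod 2 * int n)"
    by (rule dihedral_step_cong) (simp add: int_word_pos cong_def)
  then show ?thesis
    by (simp add: word_pos_def[of "u @ [(x, b)]"] cong_def)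
qed

lemma word_pos_alt_word: "k < 2 * n \<Longrightarrow> word_pos (alt_word k) = k"
  by (simp add: word_pos_def dihedral_act_alt_word)

text \<open>Reading a word from the left keeps its prefix in normal form, hence the induction that
  appends letters.\<close>

lemma deq_alt_word: "u \<approx> alt_word (word_pos u)"
proof (induction u rule: rev_induct)
  case Nil
  show ?case
    using word_pos_alt_word[of 0] n by (simp add: pres_eq.refl)
next
  case (snoc a u)
  obtain x b where a: "a = (x, b)"
    by (cases a)
  have "u @ [(x, b)] \<approx> u @ [(x, True)]"
    by (rule pres_eq_append_left[OF deq_letter])
  moreover have "u @ [(x, True)] \<approx> alt_word (word_pos u) @ [(x, True)]"
    by (rule pres_eq_append_right[OF snoc.IH])
  moreover have "alt_word (word_pos u) @ [(x, True)] \<approx> alt_word (word_pos (u @ [(x, b)]))"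
    unfolding word_pos_snoc by (rule alt_word_append[OF word_pos_less])
  ultimately show ?case
    unfolding a by (blast intro: pres_eq.trans)
qed

text \<open>This solves the word problem: the position is an invariant, and it determines the normal
  form. In particular the presentation does not collapse below \<open>2 * n\<close>
  elements.\<close>

lemma deq_iff_word_pos: "u \<approx> v \<longleftrightarrow> word_pos u = word_pos v"
proof
  assume "u \<approx> v"
  then show "word_pos u = word_pos v"
    using dihedral_act_pres_eq[of n u v 0] by (simp add: word_pos_def cong_def)
next
  assume "word_pos u = word_pos v"
  then have "u \<approx> alt_word (word_pos v)"
    using deq_alt_word[of u] by simp
  then show "u \<approx> v"
    by (rule pres_eq.trans[OF _ pres_eq.sym[OF deq_alt_word]])
qed

lemma dihedral_step_mod_iff:
  assumes "i < 2 * n" "j < 2 * n"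
  shows "(\<exists>x. j = nat (dihedral_step x (int i) mod (2 * int n))) \<longleftrightarrow>
    (i, j) \<in> parcs (cycle_graph (2 * n))"
proof -
  have succ: "nat ((int i + 1) mod (2 * int n)) = (if Suc i = 2 * n then 0 else Suc i)"
  proof (cases "Suc i = 2 * n")
    case True
    then have eq: "int i + 1 = 2 * int n"
      by simp
    show ?thesis
      unfolding eq using True by simp
  next
    case False
    then have "(int i + 1) mod (2 * int n) = int i + 1"
      using assms by (intro mod_pos_pos_trivial) auto
    then show ?thesis
      using False by simp
  qed
  have pred: "nat ((int i - 1) mod (2 * int n)) = (if i = 0 then 2 * n - 1 else i - 1)"
  proof (cases "i = 0")
    case True
    have "(- 1 :: int) mod (2 * int n) = 2 * int n - 1"
      using n by (simp add: zmod_minus1)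
    then show ?thesis
      using True by simp
  next
    case False
    then have "(int i - 1) mod (2 * int n) = int i - 1"
      using assms by (intro mod_pos_pos_trivial) auto
    then show ?thesis
      using False by simp
  qed
  \<comment> \<open>Parity decides which generator moves up and which down, but together they always
    give one move of each kind.\<close>
  have "(\<exists>x. P (dihedral_step x (int i))) \<longleftrightarrow> P (int i + 1) \<or> P (int i - 1)" for P
  proof -
    have "(\<exists>x. P (dihedral_step x (int i))) \<longleftrightarrow>
        P (dihedral_step gen_s (int i)) \<or> P (dihedral_step gen_t (int i))"
      by (metis dihedral_gen.exhaust)
    then show ?thesis
      by auto
  qed
  then have "(\<exists>x. j = nat (dihedral_step x (int i) mod (2 * int n))) \<longleftrightarrow>
      j = (if Suc i = 2 * n then 0 else Suc i) \<or> j = (if i = 0 then 2 * n - 1 else i - 1)"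
    unfolding succ[symmetric] pred[symmetric] .
  also have "\<dots> \<longleftrightarrow> (i, j) \<in> parcs (cycle_graph (2 * n))"
    using assms unfolding parcs_cycle_graph_iff by auto
  finally show ?thesis .
qed

end

section \<open>Identification of the Cayley graphs with cycles and tori\<close>

definition cayley_pair_graph :: "'a group_with_gens \<Rightarrow> 'a pair_pre_digraph" where
  "cayley_pair_graph = (\<lambda>(W, S).
    \<lparr>pverts = carrier W,
     parcs = {(x, y). x \<in> carrier W \<and> y \<in> carrier W \<and> inv\<^bsub>W\<^esub> x \<otimes>\<^bsub>W\<^esub> y \<in> S}\<rparr>)"

lemma cayley_graph_eq: "cayley_graph A = with_proj (cayley_pair_graph A)"
  by (simp add: cayley_graph_def cayley_pair_graph_def split: prod.split)

lemma pair_wf_cayley_pair_graph: "pair_wf_digraph (cayley_pair_graph A)"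
  by unfold_locales (auto simp: cayley_pair_graph_def split: prod.splits)

text \<open>Vertex \<open>k\<close> corresponds to the normal form of length \<open>k\<close>. A
  quotient is a generator exactly when right multiplication by that generator leads from one element
  to the other, which is a unit move of the position.\<close>

lemma (in dihedral) pair_iso_cayley_I2:
  "pair_iso (\<lambda>k. pres_class (I2_relators n) (alt_word k)) (cycle_graph (2 * n)) (cayley_pair_graph (I2 n))"
    (is "pair_iso ?f _ _")
proof -
  let ?W = "presented_group (I2_relators n)"
  interpret W: group ?W
    by (rule group_presented_group)
  have "bij_betw ?f {..<2 * n} (carrier ?W)"
  proof (rule bij_betw_imageI)
    show "inj_on ?f {..<2 * n}"
      by (rule inj_onI) (simp add: pres_class_eq_iff deq_iff_word_pos word_pos_alt_word)
    have "pres_class (I2_relators n) u = ?f (word_pos u)" for u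
      using deq_alt_word by (simp add: pres_class_eq_iff)
    then show "?f ` {..<2 * n} = carrier ?W"
      using word_pos_less by (auto simp: presented_group_carrier)
  qed
  moreover have "(?f i, ?f j) \<in> parcs (cayley_pair_graph (I2 n)) \<longleftrightarrow> (i, j) \<in> parcs (cycle_graph (2 * n))"
    if ij: "i < 2 * n" "j < 2 * n" for i j
  proof -
    have carr: "pres_class (I2_relators n) u \<in> carrier ?W" for u
      by (simp add: presented_group_carrier)
    have gen: "inv\<^bsub>?W\<^esub> (?f i) \<otimes>\<^bsub>?W\<^esub> ?f j = presented_gen (I2_relators n) x \<longleftrightarrow>
        j = nat (dihedral_step x (int i) mod (2 * int n))" for x
    proof -
      have "inv\<^bsub>?W\<^esub> (?f i) \<otimes>\<^bsub>?W\<^esub> ?f j = presented_gen (I2_relators n) x \<longleftrightarrow>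
          ?f j = ?f i \<otimes>\<^bsub>?W\<^esub> presented_gen (I2_relators n) x"
        using W.inv_solve_left[OF carr carr carr] by (metis presented_gen_def)
      also have "\<dots> \<longleftrightarrow> word_pos (alt_word j) = word_pos (alt_word i @ [(x, True)])"
        by (simp add: presented_gen_def presented_group_mult pres_class_eq_iff deq_iff_word_pos)
      finally show ?thesis
        by (simp add: word_pos_snoc word_pos_alt_word ij)
    qed
    have "(?f i, ?f j) \<in> parcs (cayley_pair_graph (I2 n)) \<longleftrightarrow>
        (\<exists>x. inv\<^bsub>?W\<^esub> (?f i) \<otimes>\<^bsub>?W\<^esub> ?f j = presented_gen (I2_relators n) x)"
      by (simp add: cayley_pair_graph_def I2_def carr) (metis dihedral_gen.exhaust)
    then show ?thesis
      unfolding gen using dihedral_step_mod_iff[OF ij] by simp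
  qed
  ultimately show ?thesis
    by (simp add: pair_iso_def cayley_pair_graph_def I2_def)
qed

lemma (in group) inv_mult_eq_one_iff:
  assumes "x \<in> carrier G" "y \<in> carrier G"
  shows "inv x \<otimes> y = \<one> \<longleftrightarrow> x = y"
  using inv_solve_left'[of \<one> x y] assms by auto

text \<open>A quotient in the direct product is a generator iff one component is a generator and the
  other is trivial, that is, iff one coordinate moves along an edge while the other stays
  fixed.\<close>

lemma pair_iso_cayley_prod:
  assumes "group W" "group W'"
    and f: "pair_iso f G (cayley_pair_graph (W, S))"
    and f': "pair_iso f' G' (cayley_pair_graph (W', S'))"
  shows "pair_iso (map_prod f f') (box_product G G') (cayley_pair_graph (coxeter_prod (W, S) (W', S')))"
proof -
  interpret W: group W by fact
  interpret W': group W' by fact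
  have bij: "bij_betw f (pverts G) (carrier W)" "bij_betw f' (pverts G') (carrier W')"
    using f f' by (simp_all add: pair_iso_def cayley_pair_graph_def)
  have carr: "x \<in> pverts G \<Longrightarrow> f x \<in> carrier W" "x' \<in> pverts G' \<Longrightarrow> f' x' \<in> carrier W'" for x x'
    using bij by (auto simp: bij_betw_def)
  have arc: "inv\<^bsub>W\<^esub> (f x) \<otimes>\<^bsub>W\<^esub> f y \<in> S \<longleftrightarrow> (x, y) \<in> parcs G"
    if "x \<in> pverts G" "y \<in> pverts G" for x y
    using f that carr by (simp add: pair_iso_def cayley_pair_graph_def)
  have arc': "inv\<^bsub>W'\<^esub> (f' x) \<otimes>\<^bsub>W'\<^esub> f' y \<in> S' \<longleftrightarrow> (x, y) \<in> parcs G'"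
    if "x \<in> pverts G'" "y \<in> pverts G'" for x y
    using f' that carr by (simp add: pair_iso_def cayley_pair_graph_def)
  have one: "inv\<^bsub>W\<^esub> (f x) \<otimes>\<^bsub>W\<^esub> f y = \<one>\<^bsub>W\<^esub> \<longleftrightarrow> x = y"
    if "x \<in> pverts G" "y \<in> pverts G" for x y
  proof -
    have "inv\<^bsub>W\<^esub> (f x) \<otimes>\<^bsub>W\<^esub> f y = \<one>\<^bsub>W\<^esub> \<longleftrightarrow> f x = f y"
      using that carr by (intro W.inv_mult_eq_one_iff) auto
    then show ?thesis
      using bij(1) that by (auto simp: bij_betw_def inj_on_def)
  qed
  have one': "inv\<^bsub>W'\<^esub> (f' x) \<otimes>\<^bsub>W'\<^esub> f' y = \<one>\<^bsub>W'\<^esub> \<longleftrightarrow> x = y"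
    if "x \<in> pverts G'" "y \<in> pverts G'" for x y
  proof -
    have "inv\<^bsub>W'\<^esub> (f' x) \<otimes>\<^bsub>W'\<^esub> f' y = \<one>\<^bsub>W'\<^esub> \<longleftrightarrow> f' x = f' y"
      using that carr by (intro W'.inv_mult_eq_one_iff) auto
    then show ?thesis
      using bij(2) that by (auto simp: bij_betw_def inj_on_def)
  qed
  have "(map_prod f f' v, map_prod f f' w) \<in> parcs (cayley_pair_graph (coxeter_prod (W, S) (W', S'))) \<longleftrightarrow>
      (v, w) \<in> parcs (box_product G G')"
    if vw: "v \<in> pverts G \<times> pverts G'" "w \<in> pverts G \<times> pverts G'" for v w
  proof -
    obtain x x' y y' where eq: "v = (x, x')" "w = (y, y')"
      by (cases v, cases w)
    have mem: "x \<in> pverts G" "y \<in> pverts G" "x' \<in> pverts G'" "y' \<in> pverts G'"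
      using vw eq by auto
    have "inv\<^bsub>W \<times>\<times> W'\<^esub> (f x, f' x') = (inv\<^bsub>W\<^esub> (f x), inv\<^bsub>W'\<^esub> (f' x'))"
      by (rule inv_DirProd[OF assms(1,2)]) (simp_all add: carr mem)
    then have "(map_prod f f' v, map_prod f f' w) \<in> parcs (cayley_pair_graph (coxeter_prod (W, S) (W', S'))) \<longleftrightarrow>
        inv\<^bsub>W\<^esub> (f x) \<otimes>\<^bsub>W\<^esub> f y \<in> S \<and> inv\<^bsub>W'\<^esub> (f' x') \<otimes>\<^bsub>W'\<^esub> f' y' = \<one>\<^bsub>W'\<^esub> \<or>
        inv\<^bsub>W\<^esub> (f x) \<otimes>\<^bsub>W\<^esub> f y = \<one>\<^bsub>W\<^esub> \<and> inv\<^bsub>W'\<^esub> (f' x') \<otimes>\<^bsub>W'\<^esub> f' y' \<in> S'"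
      by (simp add: eq cayley_pair_graph_def coxeter_prod_def carr mem)
    also have "\<dots> \<longleftrightarrow> (v, w) \<in> parcs (box_product G G')"
      unfolding arc[OF mem(1,2)] arc'[OF mem(3,4)] one[OF mem(1,2)] one'[OF mem(3,4)]
      using mem by (simp add: eq parcs_box_product_iff)
    finally show ?thesis .
  qed
  moreover have "bij_betw (map_prod f f') (pverts G \<times> pverts G') (carrier W \<times> carrier W')"
    by (rule bij_betw_map_prod[OF bij])
  ultimately show ?thesis
    by (simp add: pair_iso_def cayley_pair_graph_def coxeter_prod_def)
qed

text \<open>The root exceeds 1 from \<open>k = 2\<close> on and reaches 2 only at
  \<open>k = 4\<close>.\<close>

lemma ceiling_sqrt_eq_2:
  assumes "2 \<le> k" "k \<le> 4"
  shows "\<lceil>sqrt (real k)\<rceil> = 2"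
proof (rule ceiling_unique)
  show "real_of_int 2 - 1 < sqrt (real k)"
    using assms by (simp add: real_less_rsqrt)
  show "sqrt (real k) \<le> real_of_int 2"
    using assms by (intro real_le_lsqrt) auto
qed

theorem theorem6p8:
  fixes n n' :: nat
  assumes "n \<ge> 2" and "n' \<ge> 2"
  shows "int (sigma (cayley_graph (I2 n))) = \<lceil>sqrt (real (kappa (cayley_graph (I2 n))))\<rceil> \<and>
    int (sigma (cayley_graph (coxeter_prod (I2 n) (I2 n')))) =
      \<lceil>sqrt (real (kappa (cayley_graph (coxeter_prod (I2 n) (I2 n')))))\<rceil>"
proof
  interpret I: dihedral n
    using assms by unfold_locales simp
  interpret I': dihedral n'
    using assms by unfold_locales simp
  have cycle: "sigma (cayley_graph (I2 n)) = sigma (with_proj (cycle_graph (2 * n)))"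
    "kappa (cayley_graph (I2 n)) = kappa (with_proj (cycle_graph (2 * n)))"
    unfolding cayley_graph_eq
    using pair_iso_sigma[OF I.pair_iso_cayley_I2]
      pair_iso_kappa[OF I.pair_iso_cayley_I2 pair_wf_cycle_graph pair_wf_cayley_pair_graph] .
  show "int (sigma (cayley_graph (I2 n))) = \<lceil>sqrt (real (kappa (cayley_graph (I2 n))))\<rceil>"
  proof (cases "n = 2")
    case True
    then show ?thesis
      unfolding cycle using sigma_cycle_graph_4 kappa_cycle_graph_4 ceiling_sqrt_eq_2[of 2] by simp
  next
    case False
    then have "3 \<le> n"
      using assms by simp
    then show ?thesis
      using sigma_cycle_graph[of n] kappa_cycle_graph[of "2 * n"] by (simp add: cycle)
  qed
  let ?T = "box_product (cycle_graph (2 * n)) (cycle_graph (2 * n'))"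
  have iso: "pair_iso (map_prod (\<lambda>k. pres_class (I2_relators n) (alt_word k))
      (\<lambda>k. pres_class (I2_relators n') (alt_word k))) ?T
    (cayley_pair_graph (coxeter_prod (I2 n) (I2 n')))"
    using I.pair_iso_cayley_I2 I'.pair_iso_cayley_I2 unfolding I2_def
    by (rule pair_iso_cayley_prod[OF group_presented_group group_presented_group])
  have torus: "sigma (cayley_graph (coxeter_prod (I2 n) (I2 n'))) = sigma (with_proj ?T)"
    "kappa (cayley_graph (coxeter_prod (I2 n) (I2 n'))) = kappa (with_proj ?T)"
    unfolding cayley_graph_eq
    using pair_iso_sigma[OF iso] pair_iso_kappa[OF iso
        pair_wf_box_product[OF pair_wf_cycle_graph pair_wf_cycle_graph] pair_wf_cayley_pair_graph] .
  have "2 \<le> kappa (with_proj ?T)" "kappa (with_proj ?T) \<le> 4"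
    using kappa_torus[of "2 * n" "2 * n'"] assms by simp_all
  then show "int (sigma (cayley_graph (coxeter_prod (I2 n) (I2 n')))) =
      \<lceil>sqrt (real (kappa (cayley_graph (coxeter_prod (I2 n) (I2 n')))))\<rceil>"
    using ceiling_sqrt_eq_2 sigma_torus[OF assms] by (simp add: torus)
qed

end
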